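(* Let $\mathcal{M}$ be an HDMAS with finite state space $S$, $\varphi$ a state formula in normal form ($\varphi\in\mathcal{L}^0$), and $\theta$ an assignment. Then $\mathsf{globalMC}(\mathcal{M},\varphi,\theta)=[\![\varphi]\!]_\theta$, where $[\![\varphi]\!]_\theta=\{s\in S:\mathcal{M},s,\theta\models\varphi\}$.
   Context: HDMAS: countable agents; actions $act_1,\dots,act_n$ plus idle $\varepsilon$; action counters $x_1,\dots,x_n,x_\varepsilon$; $\mathcal{M}=\langle\mathit{Ag},\mathit{Act}^+,S,d,\delta,\mathit{AP},\lambda\rangle$ with available actions $d(s)\ni\varepsilon$, quantifier-free Presburger guards $\delta(s,s')$ over the counters of actions in $d(s)$ such that every assignment of natural numbers to the counters of $d(s)$ satisfies exactly one $\delta(s,s')$, and labelling $\lambda:S\to\mathcal{P}(\mathit{AP})$. An abstract joint strategy for $C$ agents assigns to each state $s$ a function from the counters of $d(s)$ to $\mathbb{N}$ with sum $C$; its outcome plays from $s$ against $N$ agents are the sequences $s_0=s,s_1,\dots$ where $s_{i+1}$ is the state whose guard $\delta(s_i,s_{i+1})$ is satisfied by the pointwise sum of the strategy's value at $s_i$ and some function from the counters of $d(s_i)$ to $\mathbb{N}$ with sum $N$. Logic: terms $T=\{y_1,y_2\}\cup\{z_1,\dots\}\cup\mathbb{N}$; assignments $\theta:T\to\mathbb{N}$ fixing numerals; state formulas $\top,p,\neg,\wedge,\vee,\langle\langle t_1,t_2\rangle\rangle\chi$ ($t_1\in T\setminus\{y_2\}$, $t_2\in T\setminus\{y_1\}$,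 $\chi\in\{\mathsf{X}\varphi,\mathsf{G}\varphi,\psi\mathsf{U}\varphi\}$), $\forall y\varphi,\exists y\varphi$ ($y\in\{y_1,y_2\}$, free occurrences of $y$ in $\varphi$ positive). $\mathcal{M},s,\theta\models\langle\langle t_1,t_2\rangle\rangle\chi$ iff some abstract joint strategy for $\theta(t_1)$ agents makes all outcome plays from $s$ against $\theta(t_2)$ agents satisfy $\chi$ (standard $\mathsf{X},\mathsf{G},\mathsf{U}$); quantifiers range over $\mathbb{N}$. Normal form: (NF1) no $\forall y_1$, no $\exists y_2$; (NF2) every $\langle\langle t_1,t_2\rangle\rangle\chi$ with exactly one of $t_1=y_1,t_2=y_2$ bound is immediately preceded by $\exists y_1$ resp. $\forall y_2$; (NF3) every $\langle\langle y_1,y_2\rangle\rangle\chi$ with both bound is immediately preceded by $\forall y_2\exists y_1$ or $\exists y_1\forall y_2$. Thus strategic subformulas have the form $\mathsf{pfix}\langle\langle t_1,t_2\rangle\rangle\chi$ with $\mathsf{pfix}$ (taken longest) in $\{\text{empty},\exists y_1,\forall y_2,\exists y_1\forall y_2,\forall y_2\exists y_1\}$. Presburger formula: for $s\in S$, $Q\subseteq S$, terms $t_1,t_2$, let $\mathit{grd}_{s,Q}=\bigvee_{s'\in Q}\delta(s,s')$ and $\mathit{prf}(\mathcal{M},s,t_1,t_2,Q)=\exists k_1\dots\exists k_n\exists k_\varepsilon\big(\bigwedge_{i}(k_i\neq0\to d^i_s)\wedge\sum_i k_i+k_\varepsilon=t_1\wedge\forall\ell_1\dots\forall\ell_n\forall\ell_\varepsilon((\bigwedge_i(\ell_i\neq0\to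 d^i_s)\wedge\sum_i\ell_i+\ell_\varepsilon=t_2)\to\mathit{grd}_{s,Q}(k_1+\ell_1,\dots,k_n+\ell_n))\big)$, where $d^i_s$ is the constant true iff $act_i\in d(s)$. $\mathsf{preImg}(\mathcal{M},t_1,t_2,Q,\theta,\mathsf{pfix})$: replace $t_1$ by $\theta(t_1)$ unless $t_1=y_1$ occurs in $\mathsf{pfix}$, likewise $t_2$ unless $t_2=y_2$ occurs in $\mathsf{pfix}$; return the set of $s\in S$ such that the Presburger sentence $\mathsf{pfix}\,\mathit{prf}(\mathcal{M},s,t_1,t_2,Q)$ is true. $\mathsf{globalMC}(\mathcal{M},\varphi,\theta)$: for $\top$ return $S$; for $p$ return $\{s:p\in\lambda(s)\}$; $\neg\psi$: complement; $\wedge,\vee$: intersection, union of recursive results. For $\mathsf{pfix}\langle\langle t_1,t_2\rangle\rangle\mathsf{X}\psi$: return $\mathsf{preImg}(\mathcal{M},t_1,t_2,\mathsf{globalMC}(\mathcal{M},\psi,\theta),\theta,\mathsf{pfix})$. For $\mathsf{pfix}\langle\langle t_1,t_2\rangle\rangle\mathsf{G}\psi$: $Q:=\mathsf{globalMC}(\mathcal{M},\psi,\theta)$, $W:=S$, $Z:=Q$; while $W\not\subseteq Z$: $W:=Z$, $Z:=\mathsf{preImg}(\mathcal{M},t_1,t_2,W,\theta,\mathsf{pfix})\cap Q$; return $Z$. For $\mathsf{pfix}\langle\langle t_1,t_2\rangle\rangle\psi_1\mathsf{U}\psi_2$: $Q_j:=\mathsf{globalMC}(\mathcal{M},\psi_j,\theta)$,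 $W:=\emptyset$, $Z:=Q_2$; while $Z\not\subseteq W$: $W:=Z$, $Z:=Q_2\cup(\mathsf{preImg}(\mathcal{M},t_1,t_2,W,\theta,\mathsf{pfix})\cap Q_1)$; return $Z$.
   Formalization: Guards are assumed not to mention the idle counter x_ε; otherwise prf, which substitutes only for x_1,…,x_n, is not a sentence, and substituting k_ε+ℓ_ε as well would make the claim false. *)

theory Defs
  imports
    "HOL-Library.Countable_Set"
    "HOL-Library.Monad_Syntax"
    "HOL-Library.While_Combinator"
begin

section \<open>Presburger arithmetic\<close>

datatype (pvars: 'v) pterm = PVar 'v | PNum nat | PAdd "'v pterm" "'v pterm"

text \<open>Congruences are not definable from the other atoms without quantifiers; they are
  included so that guards may use the language in which Presburger arithmetic has
  quantifier elimination.\<close>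

datatype (qvars: 'v) qfp =
    QTrue
  | QEq "'v pterm" "'v pterm"
  | QLess "'v pterm" "'v pterm"
  | QCong nat "'v pterm" "'v pterm"
  | QNot "'v qfp"
  | QAnd "'v qfp" "'v qfp"
  | QOr "'v qfp" "'v qfp"
  | QImp "'v qfp" "'v qfp"

datatype 'v presburger =
    QF "'v qfp"
  | PNot "'v presburger"
  | PAnd "'v presburger" "'v presburger"
  | POr "'v presburger" "'v presburger"
  | PImp "'v presburger" "'v presburger"
  | PEx 'v "'v presburger"
  | PAll 'v "'v presburger"

primrec teval :: "('v \<Rightarrow> nat) \<Rightarrow> 'v pterm \<Rightarrow> nat" where
  "teval e (PVar v) = e v"
| "teval e (PNum n) = n"
| "teval e (PAdd t u) = teval e t + teval e u"

primrec qeval :: "('v \<Rightarrow> nat) \<Rightarrow> 'v qfp \<Rightarrow> bool" where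
  "qeval e QTrue = True"
| "qeval e (QEq t u) = (teval e t = teval e u)"
| "qeval e (QLess t u) = (teval e t < teval e u)"
| "qeval e (QCong m t u) = (teval e t mod m = teval e u mod m)"
| "qeval e (QNot f) = (\<not> qeval e f)"
| "qeval e (QAnd f g) = (qeval e f \<and> qeval e g)"
| "qeval e (QOr f g) = (qeval e f \<or> qeval e g)"
| "qeval e (QImp f g) = (qeval e f \<longrightarrow> qeval e g)"

primrec peval :: "('v \<Rightarrow> nat) \<Rightarrow> 'v presburger \<Rightarrow> bool" where
  "peval e (QF f) = qeval e f"
| "peval e (PNot f) = (\<not> peval e f)"
| "peval e (PAnd f g) = (peval e f \<and> peval e g)"
| "peval e (POr f g) = (peval e f \<or> peval e g)"
| "peval e (PImp f g) = (peval e f \<longrightarrow> peval e g)"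
| "peval e (PEx v f) = (\<exists>n. peval (e(v := n)) f)"
| "peval e (PAll v f) = (\<forall>n. peval (e(v := n)) f)"

definition ptrue :: "'v presburger \<Rightarrow> bool" where
  "ptrue f \<longleftrightarrow> (\<forall>e. peval e f)"

primrec tsubst :: "('v \<Rightarrow> 'w pterm) \<Rightarrow> 'v pterm \<Rightarrow> 'w pterm" where
  "tsubst \<sigma> (PVar v) = \<sigma> v"
| "tsubst \<sigma> (PNum n) = PNum n"
| "tsubst \<sigma> (PAdd t u) = PAdd (tsubst \<sigma> t) (tsubst \<sigma> u)"

primrec qsubst :: "('v \<Rightarrow> 'w pterm) \<Rightarrow> 'v qfp \<Rightarrow> 'w qfp" where
  "qsubst \<sigma> QTrue = QTrue"
| "qsubst \<sigma> (QEq t u) = QEq (tsubst \<sigma> t) (tsubst \<sigma> u)"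
| "qsubst \<sigma> (QLess t u) = QLess (tsubst \<sigma> t) (tsubst \<sigma> u)"
| "qsubst \<sigma> (QCong m t u) = QCong m (tsubst \<sigma> t) (tsubst \<sigma> u)"
| "qsubst \<sigma> (QNot f) = QNot (qsubst \<sigma> f)"
| "qsubst \<sigma> (QAnd f g) = QAnd (qsubst \<sigma> f) (qsubst \<sigma> g)"
| "qsubst \<sigma> (QOr f g) = QOr (qsubst \<sigma> f) (qsubst \<sigma> g)"
| "qsubst \<sigma> (QImp f g) = QImp (qsubst \<sigma> f) (qsubst \<sigma> g)"

definition QAnds :: "'v qfp list \<Rightarrow> 'v qfp" where
  "QAnds fs = foldr QAnd fs QTrue"

definition QOrs :: "'v qfp list \<Rightarrow> 'v qfp" where
  "QOrs fs = foldr QOr fs (QNot QTrue)"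

definition PSum :: "'v pterm list \<Rightarrow> 'v pterm" where
  "PSum ts = foldr PAdd ts (PNum 0)"


section \<open>Homogeneous dynamic multi-agent systems\<close>

text \<open>\<open>Act i\<close> with \<open>1 \<le> i \<le> n\<close> stands for $act_i$ and \<open>Idle\<close> for $\varepsilon$.
  An action also serves as the name of its counter.\<close>

datatype act = Act nat | Idle

record ('ag, 's, 'p) hdmas =
  agents :: "'ag set"
  nacts :: nat
  states :: "'s set"
  avail :: "'s \<Rightarrow> act set"
  guard :: "'s \<Rightarrow> 's \<Rightarrow> act qfp"
  props :: "'p set"
  label :: "'s \<Rightarrow> 'p set"

definition real_acts :: "('ag, 's, 'p) hdmas \<Rightarrow> act list" where
  "real_acts M = map Act [1..<Suc (nacts M)]"

definition all_acts :: "('ag, 's, 'p) hdmas \<Rightarrow> act list" where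
  "all_acts M = real_acts M @ [Idle]"

text \<open>Guards do not mention the counter of the idle action: the formula \<open>prf_fm\<close> below
  instantiates \<open>grd\<close> with the $n$ terms $k_1+\ell_1,\dots,k_n+\ell_n$ only, and would
  otherwise not be a sentence. In the condition on assignments, the values outside the
  counters of \<open>avail M s\<close> are irrelevant because of the condition on \<open>qvars\<close>.\<close>

definition is_hdmas :: "('ag, 's, 'p) hdmas \<Rightarrow> bool" where
  "is_hdmas M \<longleftrightarrow>
     countable (agents M) \<and>
     (\<forall>s\<in>states M. Idle \<in> avail M s \<and> avail M s \<subseteq> set (all_acts M)) \<and>
     (\<forall>s\<in>states M. \<forall>s'\<in>states M. qvars (guard M s s') \<subseteq> avail M s - {Idle}) \<and>
     (\<forall>s\<in>states M. \<forall>v. \<exists>!s'. s' \<in> states M \<and> qeval v (guard M s s')) \<and>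
     (\<forall>s\<in>states M. label M s \<subseteq> props M)"

text \<open>Functions from the counters of \<open>avail M s\<close> to the naturals with sum \<open>C\<close>, extended
  by \<open>0\<close> to all counters.\<close>

definition profile :: "('ag, 's, 'p) hdmas \<Rightarrow> 's \<Rightarrow> nat \<Rightarrow> (act \<Rightarrow> nat) \<Rightarrow> bool" where
  "profile M s C f \<longleftrightarrow> (\<forall>a. a \<notin> avail M s \<longrightarrow> f a = 0) \<and> sum f (avail M s) = C"

definition joint_strategy ::
    "('ag, 's, 'p) hdmas \<Rightarrow> nat \<Rightarrow> ('s \<Rightarrow> act \<Rightarrow> nat) \<Rightarrow> bool" where
  "joint_strategy M C \<sigma> \<longleftrightarrow> (\<forall>s\<in>states M. profile M s C (\<sigma> s))"

definition outcome_play ::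
    "('ag, 's, 'p) hdmas \<Rightarrow> ('s \<Rightarrow> act \<Rightarrow> nat) \<Rightarrow> nat \<Rightarrow> 's \<Rightarrow> (nat \<Rightarrow> 's) \<Rightarrow> bool" where
  "outcome_play M \<sigma> N s \<pi> \<longleftrightarrow>
     \<pi> 0 = s \<and>
     (\<forall>i. \<pi> (Suc i) \<in> states M \<and>
          (\<exists>g. profile M (\<pi> i) N g \<and>
               qeval (\<lambda>a. \<sigma> (\<pi> i) a + g a) (guard M (\<pi> i) (\<pi> (Suc i)))))"


section \<open>The logic\<close>

datatype yvar = Y1 | Y2

datatype trm = Y yvar | Z nat | Num nat

definition is_assignment :: "(trm \<Rightarrow> nat) \<Rightarrow> bool" where
  "is_assignment \<theta> \<longleftrightarrow> (\<forall>n. \<theta> (Num n) = n)"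

datatype 'p sfm =
    Top
  | Prop 'p
  | Neg "'p sfm"
  | Conj "'p sfm" "'p sfm"
  | Disj "'p sfm" "'p sfm"
  | Strat trm trm "'p tfm"
  | FAll yvar "'p sfm"
  | FEx yvar "'p sfm"
and 'p tfm =
    Nxt "'p sfm"
  | Glob "'p sfm"
  | Until "'p sfm" "'p sfm"

text \<open>\<open>pos_free y b \<phi>\<close>: every free occurrence of \<open>y\<close> in \<open>\<phi>\<close> is positive, i.e. below an
  even number of negations, where \<open>b\<close> is the polarity at which \<open>\<phi>\<close> itself occurs.\<close>

fun pos_free :: "yvar \<Rightarrow> bool \<Rightarrow> 'p sfm \<Rightarrow> bool"
  and pos_free_t :: "yvar \<Rightarrow> bool \<Rightarrow> 'p tfm \<Rightarrow> bool" where
  "pos_free y b Top = True"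
| "pos_free y b (Prop p) = True"
| "pos_free y b (Neg \<phi>) = pos_free y (\<not> b) \<phi>"
| "pos_free y b (Conj \<phi> \<psi>) = (pos_free y b \<phi> \<and> pos_free y b \<psi>)"
| "pos_free y b (Disj \<phi> \<psi>) = (pos_free y b \<phi> \<and> pos_free y b \<psi>)"
| "pos_free y b (Strat t1 t2 \<chi>) = ((t1 = Y y \<or> t2 = Y y \<longrightarrow> b) \<and> pos_free_t y b \<chi>)"
| "pos_free y b (FAll y' \<phi>) = (y' = y \<or> pos_free y b \<phi>)"
| "pos_free y b (FEx y' \<phi>) = (y' = y \<or> pos_free y b \<phi>)"
| "pos_free_t y b (Nxt \<phi>) = pos_free y b \<phi>"
| "pos_free_t y b (Glob \<phi>) = pos_free y b \<phi>"
| "pos_free_t y b (Until \<phi> \<psi>) = (pos_free y b \<phi> \<and> pos_free y b \<psi>)"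

text \<open>State formulas over the atomic propositions \<open>A\<close>.\<close>

fun state_formula :: "'p set \<Rightarrow> 'p sfm \<Rightarrow> bool"
  and temp_formula :: "'p set \<Rightarrow> 'p tfm \<Rightarrow> bool" where
  "state_formula A Top = True"
| "state_formula A (Prop p) = (p \<in> A)"
| "state_formula A (Neg \<phi>) = state_formula A \<phi>"
| "state_formula A (Conj \<phi> \<psi>) = (state_formula A \<phi> \<and> state_formula A \<psi>)"
| "state_formula A (Disj \<phi> \<psi>) = (state_formula A \<phi> \<and> state_formula A \<psi>)"
| "state_formula A (Strat t1 t2 \<chi>) = (t1 \<noteq> Y Y2 \<and> t2 \<noteq> Y Y1 \<and> temp_formula A \<chi>)"
| "state_formula A (FAll y \<phi>) = (pos_free y True \<phi> \<and> state_formula A \<phi>)"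
| "state_formula A (FEx y \<phi>) = (pos_free y True \<phi> \<and> state_formula A \<phi>)"
| "temp_formula A (Nxt \<phi>) = state_formula A \<phi>"
| "temp_formula A (Glob \<phi>) = state_formula A \<phi>"
| "temp_formula A (Until \<phi> \<psi>) = (state_formula A \<phi> \<and> state_formula A \<psi>)"

fun sat :: "('ag, 's, 'p) hdmas \<Rightarrow> 's \<Rightarrow> (trm \<Rightarrow> nat) \<Rightarrow> 'p sfm \<Rightarrow> bool"
  and sat_play :: "('ag, 's, 'p) hdmas \<Rightarrow> (nat \<Rightarrow> 's) \<Rightarrow> (trm \<Rightarrow> nat) \<Rightarrow> 'p tfm \<Rightarrow> bool" where
  "sat M s \<theta> Top = True"
| "sat M s \<theta> (Prop p) = (p \<in> label M s)"
| "sat M s \<theta> (Neg \<phi>) = (\<not> sat M s \<theta> \<phi>)"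
| "sat M s \<theta> (Conj \<phi> \<psi>) = (sat M s \<theta> \<phi> \<and> sat M s \<theta> \<psi>)"
| "sat M s \<theta> (Disj \<phi> \<psi>) = (sat M s \<theta> \<phi> \<or> sat M s \<theta> \<psi>)"
| "sat M s \<theta> (Strat t1 t2 \<chi>) =
     (\<exists>\<sigma>. joint_strategy M (\<theta> t1) \<sigma> \<and>
          (\<forall>\<pi>. outcome_play M \<sigma> (\<theta> t2) s \<pi> \<longrightarrow> sat_play M \<pi> \<theta> \<chi>))"
| "sat M s \<theta> (FAll y \<phi>) = (\<forall>n. sat M s (\<theta>(Y y := n)) \<phi>)"
| "sat M s \<theta> (FEx y \<phi>) = (\<exists>n. sat M s (\<theta>(Y y := n)) \<phi>)"
| "sat_play M \<pi> \<theta> (Nxt \<phi>) = sat M (\<pi> 1) \<theta> \<phi>"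
| "sat_play M \<pi> \<theta> (Glob \<phi>) = (\<forall>i. sat M (\<pi> i) \<theta> \<phi>)"
| "sat_play M \<pi> \<theta> (Until \<phi> \<psi>) =
     (\<exists>i. sat M (\<pi> i) \<theta> \<psi> \<and> (\<forall>j<i. sat M (\<pi> j) \<theta> \<phi>))"

definition extension :: "('ag, 's, 'p) hdmas \<Rightarrow> (trm \<Rightarrow> nat) \<Rightarrow> 'p sfm \<Rightarrow> 's set" where
  "extension M \<theta> \<phi> = {s \<in> states M. sat M s \<theta> \<phi>}"


section \<open>Normal form\<close>

datatype quant = AllQ yvar | ExQ yvar

text \<open>In \<open>nf B qs \<phi>\<close>, \<open>B\<close> is the set of variables bound at the position of \<open>\<phi>\<close> and \<open>qs\<close>
  the list of the quantifiers immediately preceding \<open>\<phi>\<close>, the closest one first.\<close>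

fun nf :: "yvar set \<Rightarrow> quant list \<Rightarrow> 'p sfm \<Rightarrow> bool"
  and nf_t :: "yvar set \<Rightarrow> 'p tfm \<Rightarrow> bool" where
  "nf B qs Top = True"
| "nf B qs (Prop p) = True"
| "nf B qs (Neg \<phi>) = nf B [] \<phi>"
| "nf B qs (Conj \<phi> \<psi>) = (nf B [] \<phi> \<and> nf B [] \<psi>)"
| "nf B qs (Disj \<phi> \<psi>) = (nf B [] \<phi> \<and> nf B [] \<psi>)"
| "nf B qs (Strat t1 t2 \<chi>) =
     ((let b1 = (t1 = Y Y1 \<and> Y1 \<in> B); b2 = (t2 = Y Y2 \<and> Y2 \<in> B) in
         (b1 \<and> \<not> b2 \<longrightarrow> take 1 qs = [ExQ Y1]) \<and>
         (b2 \<and> \<not> b1 \<longrightarrow> take 1 qs = [AllQ Y2]) \<and>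
         (b1 \<and> b2 \<longrightarrow> take 2 qs = [ExQ Y1, AllQ Y2] \<or> take 2 qs = [AllQ Y2, ExQ Y1])) \<and>
      nf_t B \<chi>)"
| "nf B qs (FAll y \<phi>) = (y \<noteq> Y1 \<and> nf (insert y B) (AllQ y # qs) \<phi>)"
| "nf B qs (FEx y \<phi>) = (y \<noteq> Y2 \<and> nf (insert y B) (ExQ y # qs) \<phi>)"
| "nf_t B (Nxt \<phi>) = nf B [] \<phi>"
| "nf_t B (Glob \<phi>) = nf B [] \<phi>"
| "nf_t B (Until \<phi> \<psi>) = (nf B [] \<phi> \<and> nf B [] \<psi>)"

definition normal_form :: "'p sfm \<Rightarrow> bool" where
  "normal_form \<phi> \<longleftrightarrow> nf {} [] \<phi>"


section \<open>The model checking algorithm\<close>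

text \<open>The variables $k_a$, $\ell_a$ (for an action $a$), $y_1$ and $y_2$.\<close>

datatype mcvar = K act | L act | PY yvar

text \<open>The order of the disjuncts of \<open>grd\<close> does not matter.\<close>

definition enum_of :: "'s set \<Rightarrow> 's list" where
  "enum_of A = (SOME xs. set xs = A \<and> distinct xs)"

definition grd :: "('ag, 's, 'p) hdmas \<Rightarrow> 's \<Rightarrow> 's set \<Rightarrow> act qfp" where
  "grd M s Q = QOrs (map (guard M s) (enum_of Q))"

definition action_cond ::
    "('ag, 's, 'p) hdmas \<Rightarrow> 's \<Rightarrow> (act \<Rightarrow> mcvar) \<Rightarrow> mcvar pterm \<Rightarrow> mcvar qfp" where
  "action_cond M s v t =
     QAnd
       (QAnds (map (\<lambda>a. QImp (QNot (QEq (PVar (v a)) (PNum 0)))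
                             (if a \<in> avail M s then QTrue else QNot QTrue))
                   (real_acts M)))
       (QEq (PSum (map (\<lambda>a. PVar (v a)) (all_acts M))) t)"

definition prf_fm ::
    "('ag, 's, 'p) hdmas \<Rightarrow> 's \<Rightarrow> mcvar pterm \<Rightarrow> mcvar pterm \<Rightarrow> 's set \<Rightarrow> mcvar presburger" where
  "prf_fm M s t1 t2 Q =
     foldr (\<lambda>a. PEx (K a)) (all_acts M)
       (PAnd (QF (action_cond M s K t1))
         (foldr (\<lambda>a. PAll (L a)) (all_acts M)
           (PImp (QF (action_cond M s L t2))
             (QF (qsubst (\<lambda>a. PAdd (PVar (K a)) (PVar (L a))) (grd M s Q))))))"

text \<open>Prefixes \<open>pfix\<close> are lists of quantifiers, the outermost one first.\<close>

primrec close :: "quant list \<Rightarrow> mcvar presburger \<Rightarrow> mcvar presburger" where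
  "close [] f = f"
| "close (q # qs) f =
     (case q of AllQ y \<Rightarrow> PAll (PY y) (close qs f) | ExQ y \<Rightarrow> PEx (PY y) (close qs f))"

fun inst :: "(trm \<Rightarrow> nat) \<Rightarrow> quant list \<Rightarrow> trm \<Rightarrow> mcvar pterm" where
  "inst \<theta> pfix (Y y) =
     (if AllQ y \<in> set pfix \<or> ExQ y \<in> set pfix then PVar (PY y) else PNum (\<theta> (Y y)))"
| "inst \<theta> pfix t = PNum (\<theta> t)"

definition preImg ::
    "('ag, 's, 'p) hdmas \<Rightarrow> trm \<Rightarrow> trm \<Rightarrow> 's set \<Rightarrow> (trm \<Rightarrow> nat) \<Rightarrow> quant list \<Rightarrow> 's set" where
  "preImg M t1 t2 Q \<theta> pfix =
     {s \<in> states M. ptrue (close pfix (prf_fm M s (inst \<theta> pfix t1) (inst \<theta> pfix t2) Q))}"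

text \<open>The result \<open>None\<close> means that some while loop does not terminate. In the function below,
  the equations are tried in order, so that the prefix of a strategic operator is taken as
  long as possible. The last two equations of \<open>globalMC\<close> apply to a quantifier that is not
  part of such a prefix. The algorithm has no case for these; in a formula in normal form
  such a quantifier binds no occurrence of its variable, and it is skipped.\<close>

fun globalMC :: "('ag, 's, 'p) hdmas \<Rightarrow> 'p sfm \<Rightarrow> (trm \<Rightarrow> nat) \<Rightarrow> 's set option"
  and stratMC :: "('ag, 's, 'p) hdmas \<Rightarrow> quant list \<Rightarrow> trm \<Rightarrow> trm \<Rightarrow> 'p tfm \<Rightarrow> (trm \<Rightarrow> nat)
                  \<Rightarrow> 's set option" where
  "globalMC M Top \<theta> = Some (states M)"
| "globalMC M (Prop p) \<theta> = Some {s \<in> states M. p \<in> label M s}"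
| "globalMC M (Neg \<psi>) \<theta> = do { A \<leftarrow> globalMC M \<psi> \<theta>; Some (states M - A) }"
| "globalMC M (Conj \<phi> \<psi>) \<theta> =
     do { A \<leftarrow> globalMC M \<phi> \<theta>; B \<leftarrow> globalMC M \<psi> \<theta>; Some (A \<inter> B) }"
| "globalMC M (Disj \<phi> \<psi>) \<theta> =
     do { A \<leftarrow> globalMC M \<phi> \<theta>; B \<leftarrow> globalMC M \<psi> \<theta>; Some (A \<union> B) }"
| "globalMC M (FEx Y1 (FAll Y2 (Strat t1 t2 \<chi>))) \<theta> = stratMC M [ExQ Y1, AllQ Y2] t1 t2 \<chi> \<theta>"
| "globalMC M (FAll Y2 (FEx Y1 (Strat t1 t2 \<chi>))) \<theta> = stratMC M [AllQ Y2, ExQ Y1] t1 t2 \<chi> \<theta>"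
| "globalMC M (FEx Y1 (Strat t1 t2 \<chi>)) \<theta> = stratMC M [ExQ Y1] t1 t2 \<chi> \<theta>"
| "globalMC M (FAll Y2 (Strat t1 t2 \<chi>)) \<theta> = stratMC M [AllQ Y2] t1 t2 \<chi> \<theta>"
| "globalMC M (Strat t1 t2 \<chi>) \<theta> = stratMC M [] t1 t2 \<chi> \<theta>"
| "globalMC M (FEx y \<phi>) \<theta> = globalMC M \<phi> \<theta>"
| "globalMC M (FAll y \<phi>) \<theta> = globalMC M \<phi> \<theta>"
| "stratMC M pfix t1 t2 (Nxt \<psi>) \<theta> =
     do { Q \<leftarrow> globalMC M \<psi> \<theta>; Some (preImg M t1 t2 Q \<theta> pfix) }"
| "stratMC M pfix t1 t2 (Glob \<psi>) \<theta> =
     do { Q \<leftarrow> globalMC M \<psi> \<theta>;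
          (W, Z) \<leftarrow> while_option (\<lambda>(W, Z). \<not> W \<subseteq> Z)
                      (\<lambda>(W, Z). (Z, preImg M t1 t2 Z \<theta> pfix \<inter> Q)) (states M, Q);
          Some Z }"
| "stratMC M pfix t1 t2 (Until \<psi>1 \<psi>2) \<theta> =
     do { Q1 \<leftarrow> globalMC M \<psi>1 \<theta>;
          Q2 \<leftarrow> globalMC M \<psi>2 \<theta>;
          (W, Z) \<leftarrow> while_option (\<lambda>(W, Z). \<not> Z \<subseteq> W)
                      (\<lambda>(W, Z). (Z, Q2 \<union> (preImg M t1 t2 Z \<theta> pfix \<inter> Q1))) ({}, Q2);
          Some Z }"

end

(*
  An additional agent can always idle, and no guard notices it. So for a fixed target set the
  controllable preimage of C agents against N opponents grows with C and shrinks with N. As a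
  function on sets of states it ranges over a finite lattice, so that the supremum over y1 and
  the infimum over y2 in a prefix are attained. Hence they commute with every monotone
  construction, in particular with the fixpoints that describe G and U for fixed C and N: the
  fixpoint of the quantified preimage, which the algorithm computes, is the quantified fixpoint.
  The normal form ensures that the arguments of a temporal operator do not depend on the
  variables that are quantified in front of it.
*)

theory Submission
  imports Defs
begin

section \<open>Quantifier prefixes over finite lattices\<close>

text \<open>A strategic operator fixes the numbers of agents once, before the whole play. A loop of
  the algorithm instead evaluates the prefix anew at every state and in every iteration, and each
  time the witness for y1 or the counterexample for y2 may be a different number. Attainment
  therefore has to be uniform: one number must serve all states and all target sets at once. This is
  why prefixes are evaluated in a lattice of functions from sets of states to sets of states, not
  state by state. The value F Q, the greatest fixpoint of F X \<inter> Q and the least fixpoint of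
  Q2 \<union> (F X \<inter> Q1) are all monotone in F, so one commutation argument covers X, G and
  U. Evaluation of F at a single target set is monotone too, which links the Presburger sentences to
  this lattice. Alternating prefixes need no separate treatment, because quantifiers are peeled off
  one at a time.\<close>

lemma SUP_attained:
  fixes A :: "nat \<Rightarrow> 'a::complete_lattice"
  assumes "mono A" "finite (range A)"
  obtains n where "(SUP n. A n) = A n"
proof -
  obtain n where n: "\<forall>b\<in>range A. A n \<le> b \<longrightarrow> A n = b"
    using finite_has_maximal[OF assms(2)] by auto
  \<comment> \<open>Maximal becomes greatest: \<open>A (max k n)\<close> lies above both values, and
    by maximality it equals \<open>A n\<close>.\<close>
  have "A k \<le> A n" for k
  proof -
    have "A n = A (max k n)" using n assms(1) by (auto simp: mono_def)
    moreover have "A k \<le> A (max k n)" using assms(1) by (auto simp: mono_def)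
    ultimately show ?thesis by simp
  qed
  then have "(SUP n. A n) = A n" by (intro antisym SUP_least SUP_upper) auto
  then show thesis by (rule that)
qed

lemma INF_attained:
  fixes A :: "nat \<Rightarrow> 'a::complete_lattice"
  assumes "antimono A" "finite (range A)"
  obtains n where "(INF n. A n) = A n"
proof -
  obtain n where n: "\<forall>b\<in>range A. b \<le> A n \<longrightarrow> A n = b"
    using finite_has_minimal[OF assms(2)] by auto
  have "A n \<le> A k" for k
  proof -
    have "A n = A (max k n)" using n assms(1) by (auto simp: antimono_def)
    moreover have "A (max k n) \<le> A k" using assms(1) by (auto simp: antimono_def)
    ultimately show ?thesis by simp
  qed
  then have "(INF n. A n) = A n" by (intro antisym INF_greatest INF_lower) auto
  then show thesis by (rule that)
qed

text \<open>The conditions on \<open>{}\<close> and \<open>S\<close> serve the loops, whose first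
  iterate is an argument set instead of a value of the preimage. The last condition makes a function
  depend only on its restriction to subsets of \<open>S\<close>, since the type of states may be
  infinite.\<close>

definition preimage_fns :: "'s set \<Rightarrow> ('s set \<Rightarrow> 's set) set" where
  "preimage_fns S = {F. mono F \<and> F {} = {} \<and> F S = S \<and> (\<forall>X. F X \<subseteq> S) \<and> (\<forall>X. F (X \<inter> S) = F X)}"

text \<open>Such a function is recovered from the relation between subsets of \<open>S\<close> and
  the elements of their images, and there are finitely many relations of this kind.\<close>

lemma finite_preimage_fns:
  assumes "finite S"
  shows "finite (preimage_fns S)"
proof (rule inj_on_finite)
  let ?g = "\<lambda>F. {(X, s). X \<subseteq> S \<and> s \<in> F X}"
  show "inj_on ?g (preimage_fns S)"
  proof (rule inj_onI, rule ext)
    fix F G X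
    assume F: "F \<in> preimage_fns S" and G: "G \<in> preimage_fns S" and eq: "?g F = ?g G"
    have "s \<in> F (X \<inter> S) \<longleftrightarrow> s \<in> G (X \<inter> S)" for s
      using eq unfolding set_eq_iff by (auto dest: spec[of _ "X \<inter> S"])
    then show "F X = G X"
      using F G by (auto simp: preimage_fns_def)
  qed
  show "?g ` preimage_fns S \<subseteq> Pow (Pow S \<times> S)"
    by (auto simp: preimage_fns_def)
  show "finite (Pow (Pow S \<times> S))" using assms by simp
qed

lemma SUP_preimage_fns:
  fixes F :: "nat \<Rightarrow> 's set \<Rightarrow> 's set"
  assumes "\<And>n. F n \<in> preimage_fns S"
  shows "(SUP n. F n) \<in> preimage_fns S"
proof -
  have F: "mono (F n)" "F n {} = {}" "F n S = S" "F n X \<subseteq> S" "F n (X \<inter> S) = F n X" for n X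
    using assms[of n] by (simp_all add: preimage_fns_def)
  have "mono (\<lambda>X. \<Union>n. F n X)"
    by (intro monoI SUP_mono' monoD[OF F(1)])
  moreover have "(SUP n. F n) = (\<lambda>X. \<Union>n. F n X)" by (rule ext) simp
  moreover have "(\<Union>n. F n X) \<subseteq> S" for X using F(4) by blast
  ultimately show ?thesis by (simp add: preimage_fns_def F(2,3,5))
qed

text \<open>The index type is nonempty, so an intersection still lies below \<open>S\<close>, and
  \<open>{}\<close> and \<open>S\<close> are still mapped to themselves.\<close>

lemma INF_preimage_fns:
  fixes F :: "nat \<Rightarrow> 's set \<Rightarrow> 's set"
  assumes "\<And>n. F n \<in> preimage_fns S"
  shows "(INF n. F n) \<in> preimage_fns S"
proof -
  have F: "mono (F n)" "F n {} = {}" "F n S = S" "F n X \<subseteq> S" "F n (X \<inter> S) = F n X" for n X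
    using assms[of n] by (simp_all add: preimage_fns_def)
  have "mono (\<lambda>X. \<Inter>n. F n X)"
    by (intro monoI INF_mono' monoD[OF F(1)])
  moreover have "(INF n. F n) = (\<lambda>X. \<Inter>n. F n X)" by (rule ext) simp
  moreover have "(\<Inter>n. F n X) \<subseteq> S" for X using F(4) by blast
  ultimately show ?thesis by (simp add: preimage_fns_def F(2,3,5))
qed

text \<open>Polymorphic in the lattice because a prefix is read at two levels: over sets of states,
  for formulas and sentences, and over preimage functions, where attainment is uniform.\<close>

fun interp :: "quant list \<Rightarrow> ((trm \<Rightarrow> nat) \<Rightarrow> 'a::complete_lattice) \<Rightarrow> (trm \<Rightarrow> nat) \<Rightarrow> 'a" where
  "interp [] A \<theta> = A \<theta>"
| "interp (AllQ y # qs) A \<theta> = (INF n. interp qs A (\<theta>(Y y := n)))"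
| "interp (ExQ y # qs) A \<theta> = (SUP n. interp qs A (\<theta>(Y y := n)))"

abbreviation qvar :: "quant \<Rightarrow> yvar" where
  "qvar q \<equiv> (case q of AllQ y \<Rightarrow> y | ExQ y \<Rightarrow> y)"

definition directed_fns :: "'s set \<Rightarrow> ((trm \<Rightarrow> nat) \<Rightarrow> 's set \<Rightarrow> 's set) \<Rightarrow> bool" where
  "directed_fns S A \<longleftrightarrow>
     (\<forall>\<theta>. A \<theta> \<in> preimage_fns S) \<and>
     (\<forall>\<theta>. mono (\<lambda>n. A (\<theta>(Y Y1 := n)))) \<and>
     (\<forall>\<theta>. antimono (\<lambda>n. A (\<theta>(Y Y2 := n))))"

text \<open>Inner quantifiers preserve the monotone dependence on an outer variable, so at every
  level of a prefix the outermost quantifier ranges over a monotone sequence.\<close>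

lemma interp_mono:
  assumes "\<And>\<theta>. mono (\<lambda>n. A (\<theta>(Y y := n)))"
  shows "mono (\<lambda>n. interp qs A (\<theta>(Y y := n)))"
proof (induction qs arbitrary: \<theta>)
  case Nil
  show ?case using assms by (simp del: fun_upd_apply)
next
  case (Cons q qs)
  \<comment> \<open>If the quantifier rebinds \<open>y\<close>, the outer value is overwritten and
    both sides coincide; otherwise the two updates commute.\<close>
  have *: "interp qs A (\<theta>(Y y := m, Y y' := k)) \<le> interp qs A (\<theta>(Y y := n, Y y' := k))"
    if "m \<le> n" for m n k y'
  proof (cases "y' = y")
    case False
    then show ?thesis
      using monoD[OF Cons[of "\<theta>(Y y' := k)"] that]
      by (simp add: fun_upd_twist[of "Y y" "Y y'"] del: fun_upd_apply)
  qed simp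
  show ?case
    by (cases q) (auto intro!: monoI SUP_mono' INF_mono' * simp del: fun_upd_apply)
qed

lemma interp_antimono:
  assumes "\<And>\<theta>. antimono (\<lambda>n. A (\<theta>(Y y := n)))"
  shows "antimono (\<lambda>n. interp qs A (\<theta>(Y y := n)))"
proof (induction qs arbitrary: \<theta>)
  case Nil
  show ?case using assms by (simp del: fun_upd_apply)
next
  case (Cons q qs)
  have *: "interp qs A (\<theta>(Y y := n, Y y' := k)) \<le> interp qs A (\<theta>(Y y := m, Y y' := k))"
    if "m \<le> n" for m n k y'
  proof (cases "y' = y")
    case False
    then show ?thesis
      using antimonoD[OF Cons[of "\<theta>(Y y' := k)"] that]
      by (simp add: fun_upd_twist[of "Y y" "Y y'"] del: fun_upd_apply)
  qed simp
  show ?case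
    by (cases q) (auto intro!: antimonoI SUP_mono' INF_mono' * simp del: fun_upd_apply)
qed

lemma interp_preimage_fns:
  assumes "directed_fns S A"
  shows "interp qs A \<theta> \<in> preimage_fns S"
proof (induction qs arbitrary: \<theta>)
  case Nil
  then show ?case using assms by (simp add: directed_fns_def)
next
  case (Cons q qs)
  then show ?case
    by (cases q) (simp_all only: interp.simps SUP_preimage_fns INF_preimage_fns)
qed

text \<open>Each supremum and infimum of a prefix ranges over a monotone sequence in a finite
  lattice and is attained, so it commutes with every monotone map, in particular with
  taking fixpoints.\<close>

lemma interp_commute:
  assumes S: "finite S" and A: "directed_fns S A" and \<Phi>: "mono \<Phi>"
    and qs: "set qs \<subseteq> {ExQ Y1, AllQ Y2}"
  shows "\<Phi> (interp qs A \<theta>) = interp qs (\<lambda>\<theta>. \<Phi> (A \<theta>)) \<theta>"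
  using qs
proof (induction qs arbitrary: \<theta>)
  case (Cons q qs)
  let ?B = "\<lambda>y n. interp qs A (\<theta>(Y y := n))"
  have fin: "finite (range (?B y))" for y
    using interp_preimage_fns[OF A] finite_preimage_fns[OF S]
    by (meson finite_subset image_subsetI)
  consider "q = ExQ Y1" | "q = AllQ Y2" using Cons.prems by auto
  then show ?case
  proof cases
    case 1
    have "mono (?B Y1)" using A by (intro interp_mono) (simp add: directed_fns_def)
    then obtain n where n: "(SUP n. ?B Y1 n) = ?B Y1 n"
      using SUP_attained fin by blast
    have "(SUP n. \<Phi> (?B Y1 n)) = \<Phi> (SUP n. ?B Y1 n)"
    proof (rule antisym)
      show "(SUP n. \<Phi> (?B Y1 n)) \<le> \<Phi> (SUP n. ?B Y1 n)"
        by (intro SUP_least monoD[OF \<Phi>] SUP_upper) auto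
      \<comment> \<open>Of the two inequalities, only this one uses attainment; the other is
        monotonicity of \<open>\<Phi>\<close>.\<close>
      show "\<Phi> (SUP n. ?B Y1 n) \<le> (SUP n. \<Phi> (?B Y1 n))"
        unfolding n by (intro SUP_upper) auto
    qed
    then show ?thesis using 1 Cons by (simp del: fun_upd_apply SUP_apply INF_apply Sup_apply Inf_apply)
  next
    case 2
    have "antimono (?B Y2)" using A by (intro interp_antimono) (simp add: directed_fns_def)
    then obtain n where n: "(INF n. ?B Y2 n) = ?B Y2 n"
      using INF_attained fin by blast
    have "(INF n. \<Phi> (?B Y2 n)) = \<Phi> (INF n. ?B Y2 n)"
    proof (rule antisym)
      show "\<Phi> (INF n. ?B Y2 n) \<le> (INF n. \<Phi> (?B Y2 n))"
        by (intro INF_greatest monoD[OF \<Phi>] INF_lower) auto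
      show "(INF n. \<Phi> (?B Y2 n)) \<le> \<Phi> (INF n. ?B Y2 n)"
        unfolding n by (intro INF_lower) auto
    qed
    then show ?thesis using 2 Cons by (simp del: fun_upd_apply SUP_apply INF_apply Sup_apply Inf_apply)
  qed
qed simp

text \<open>A prefix evaluates its body only at assignments that differ from \<open>\<theta>\<close>
  in variables of the prefix. At these assignments the arguments of a temporal operator will be seen
  to denote fixed sets.\<close>

lemma interp_cong:
  assumes "\<And>\<theta>'. (\<And>t. t \<notin> Y ` qvar ` set qs \<Longrightarrow> \<theta>' t = \<theta> t) \<Longrightarrow> A \<theta>' = B \<theta>'"
  shows "interp qs A \<theta> = interp qs B \<theta>"
  using assms
proof (induction qs arbitrary: \<theta>)
  case (Cons q qs)
  have "interp qs A (\<theta>(Y (qvar q) := n)) = interp qs B (\<theta>(Y (qvar q) := n))" for n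
    by (rule Cons.IH, rule Cons.prems) (auto split: if_splits)
  then show ?case by (cases q) auto
qed simp

text \<open>The variables of the prefix are overwritten before the body is reached. This is what
  makes the truth of the closed formulas independent of the environment.\<close>

lemma interp_agree:
  assumes "\<And>t. t \<notin> Y ` qvar ` set qs \<Longrightarrow> \<theta>' t = \<theta> t"
  shows "interp qs A \<theta>' = interp qs A \<theta>"
  using assms
proof (induction qs arbitrary: \<theta> \<theta>')
  case Nil
  then have "\<theta>' = \<theta>" by auto
  then show ?case by simp
next
  case (Cons q qs)
  have "interp qs A (\<theta>'(Y (qvar q) := n)) = interp qs A (\<theta>(Y (qvar q) := n))" for n
    by (rule Cons.IH) (use Cons.prems in auto)
  then show ?case by (cases q) auto
qed


section \<open>Loops computing fixpoints\<close>

text \<open>\<open>G\<close> is the function that the program computes and agrees with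
  \<open>F\<close> only on subsets of \<open>S\<close>. The start \<open>(S, G S)\<close> is the
  pair of \<open>S\<close> and the argument set once the preimage is known to map \<open>S\<close>
  to \<open>S\<close>.\<close>

lemma while_option_gfp:
  assumes F: "mono F" and S: "finite S" "\<And>X. F X \<subseteq> S"
    and G: "\<And>X. X \<subseteq> S \<Longrightarrow> G X = F X"
  shows "\<exists>W. while_option (\<lambda>(W, V). \<not> W \<subseteq> V) (\<lambda>(W, V). (V, G V)) (S, G S) = Some (W, gfp F)"
proof -
  let ?b = "\<lambda>(W, V). \<not> W \<subseteq> V" and ?c = "\<lambda>(W, V). (V, G V)"
  \<comment> \<open>The second component is always one application ahead of the first. The iterates
    descend and stay above \<open>gfp F\<close>, so the exit test turns \<open>W\<close> into a
    fixpoint.\<close>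
  define I where "I = (\<lambda>(W, V). V = F W \<and> F W \<subseteq> W \<and> W \<subseteq> S \<and> gfp F \<subseteq> F W)"
  have *: "gfp F \<subseteq> F X" if "gfp F \<subseteq> X" for X
    by (subst gfp_unfold[OF F]) (rule monoD[OF F that])
  have "gfp F \<subseteq> S" by (subst gfp_unfold[OF F]) (rule S(2))
  then have init: "I (S, G S)" using S(2)[of S] *[of S] G[of S] by (simp add: I_def)
  have step: "I (?c x)" if "I x" for x
  proof (cases x)
    case (Pair W V)
    then show ?thesis
      using that monoD[OF F, of V W] *[of V] S(2)[of W] G[of V] by (simp add: I_def)
  qed
  have "\<exists>t. while_option ?b ?c (S, G S) = Some t"
  \<comment> \<open>The next first component is \<open>V\<close>, which lies inside \<open>W\<close>
    by the invariant and differs from it as long as the test succeeds.\<close>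
  proof (rule measure_while_option_Some[where P = I and f = "card \<circ> fst"])
    fix x assume x: "I x" "?b x"
    then have "card (snd x) < card (fst x)"
      using S(1) by (intro psubset_card_mono) (auto simp: I_def dest: finite_subset)
    then show "I (?c x) \<and> (card \<circ> fst) (?c x) < (card \<circ> fst) x"
      using step[OF x(1)] by (simp add: case_prod_beta)
  qed (rule init)
  then obtain W V where t: "while_option ?b ?c (S, G S) = Some (W, V)" by auto
  have I: "I (W, V)"
    by (rule while_option_rule[where P = I, OF step t init])
  moreover have "W \<subseteq> V" using while_option_stop[OF t] by simp
  ultimately have "F W = W" "V = W" by (simp_all add: I_def)
  then have "V \<subseteq> gfp F" by (intro gfp_upperbound) simp
  moreover have "gfp F \<subseteq> V" using I by (simp add: I_def)
  ultimately have "V = gfp F" by (rule antisym)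
  then show ?thesis using t by simp
qed

text \<open>Dual to the descending loop: the iterates grow inside \<open>S\<close>, and the part of
  \<open>S\<close> not yet reached shrinks.\<close>

lemma while_option_lfp:
  assumes F: "mono F" and S: "finite S" "\<And>X. X \<subseteq> S \<Longrightarrow> F X \<subseteq> S"
    and G: "\<And>X. X \<subseteq> S \<Longrightarrow> G X = F X"
  shows "\<exists>W. while_option (\<lambda>(W, V). \<not> V \<subseteq> W) (\<lambda>(W, V). (V, G V)) ({}, G {}) = Some (W, lfp F)"
proof -
  let ?b = "\<lambda>(W, V). \<not> V \<subseteq> W" and ?c = "\<lambda>(W, V). (V, G V)"
  define I where "I = (\<lambda>(W, V). V = F W \<and> W \<subseteq> F W \<and> F W \<subseteq> S \<and> F W \<subseteq> lfp F)"
  have *: "F X \<subseteq> lfp F" if "X \<subseteq> lfp F" for X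
    by (subst lfp_unfold[OF F]) (rule monoD[OF F that])
  then have init: "I ({}, G {})" using S(2)[of "{}"] G[of "{}"] by (simp add: I_def)
  have step: "I (?c x)" if "I x" for x
  proof (cases x)
    case (Pair W V)
    then show ?thesis
      using that monoD[OF F, of W V] *[of V] S(2)[of V] G[of V] by (simp add: I_def)
  qed
  have "\<exists>t. while_option ?b ?c ({}, G {}) = Some t"
  proof (rule measure_while_option_Some[where P = I and f = "\<lambda>x. card (S - fst x)"])
    fix x assume x: "I x" "?b x"
    then have "card (S - snd x) < card (S - fst x)"
      using S(1) by (intro psubset_card_mono) (auto simp: I_def)
    then show "I (?c x) \<and> card (S - fst (?c x)) < card (S - fst x)"
      using step[OF x(1)] by (simp add: case_prod_beta)
  qed (rule init)
  then obtain W V where t: "while_option ?b ?c ({}, G {}) = Some (W, V)" by auto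
  have I: "I (W, V)"
    by (rule while_option_rule[where P = I, OF step t init])
  moreover have "V \<subseteq> W" using while_option_stop[OF t] by simp
  ultimately have "F W = W" "V = W" by (simp_all add: I_def)
  then have "lfp F \<subseteq> V" by (intro lfp_lowerbound) simp
  moreover have "V \<subseteq> lfp F" using I by (simp add: I_def)
  ultimately have "V = lfp F" by (intro antisym)
  then show ?thesis using t by simp
qed


section \<open>Outcomes of joint strategies\<close>

definition succs :: "('ag, 's, 'p) hdmas \<Rightarrow> 's \<Rightarrow> (act \<Rightarrow> nat) \<Rightarrow> nat \<Rightarrow> 's set" where
  "succs M s f N =
     {s' \<in> states M. \<exists>g. profile M s N g \<and> qeval (\<lambda>a. f a + g a) (guard M s s')}"

definition cpre :: "('ag, 's, 'p) hdmas \<Rightarrow> nat \<Rightarrow> nat \<Rightarrow> 's set \<Rightarrow> 's set" where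
  "cpre M C N X = {s \<in> states M. \<exists>f. profile M s C f \<and> succs M s f N \<subseteq> X}"

text \<open>The goal is a predicate on plays and not a temporal formula, so that it can be shifted
  along a play by one step.\<close>

definition win :: "('ag, 's, 'p) hdmas \<Rightarrow> nat \<Rightarrow> nat \<Rightarrow> ((nat \<Rightarrow> 's) \<Rightarrow> bool) \<Rightarrow> 's set" where
  "win M C N P = {s \<in> states M. \<exists>\<sigma>. joint_strategy M C \<sigma> \<and>
     (\<forall>\<pi>. outcome_play M \<sigma> N s \<pi> \<longrightarrow> P \<pi>)}"

lemma outcome_play_iff_succs:
  "outcome_play M \<sigma> N s \<pi> \<longleftrightarrow> \<pi> 0 = s \<and> (\<forall>i. \<pi> (Suc i) \<in> succs M (\<pi> i) (\<sigma> (\<pi> i)) N)"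
  by (auto simp: outcome_play_def succs_def)

lemma teval_cong: "(\<And>v. v \<in> pvars t \<Longrightarrow> e v = e' v) \<Longrightarrow> teval e t = teval e' t"
  by (induction t) auto

lemma qeval_cong: "(\<And>v. v \<in> qvars f \<Longrightarrow> e v = e' v) \<Longrightarrow> qeval e f = qeval e' f"
proof (induction f)
  case (QEq t u)
  then show ?case using teval_cong[of t e e'] teval_cong[of u e e'] by simp
next
  case (QLess t u)
  then show ?case using teval_cong[of t e e'] teval_cong[of u e e'] by simp
next
  case (QCong m t u)
  then show ?case using teval_cong[of t e e'] teval_cong[of u e e'] by simp
qed (simp; blast)+

lemma set_all_acts: "set (all_acts M) = insert Idle (set (real_acts M))"
  by (auto simp: all_acts_def)

lemma distinct_all_acts: "distinct (all_acts M)"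
  by (auto simp: all_acts_def real_acts_def distinct_map inj_on_def)

section \<open>Profiles, successors and the controllable preimage\<close>

context
  fixes M :: "('ag, 's, 'p) hdmas"
  assumes M: "is_hdmas M"
begin

lemma finite_avail: "s \<in> states M \<Longrightarrow> finite (avail M s)"
  using M by (meson is_hdmas_def List.finite_set finite_subset)

lemma avail_subset: "s \<in> states M \<Longrightarrow> avail M s \<subseteq> set (all_acts M)"
  using M by (simp add: is_hdmas_def)

lemma Idle_avail: "s \<in> states M \<Longrightarrow> Idle \<in> avail M s"
  using M by (simp add: is_hdmas_def)

lemma guard_ex1: "s \<in> states M \<Longrightarrow> \<exists>!s'. s' \<in> states M \<and> qeval v (guard M s s')"
  using M by (simp add: is_hdmas_def)

lemma guard_cong:
  assumes "s \<in> states M" "s' \<in> states M" "\<And>a. a \<in> avail M s - {Idle} \<Longrightarrow> v a = w a"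
  shows "qeval v (guard M s s') = qeval w (guard M s s')"
proof (rule qeval_cong)
  fix a assume "a \<in> qvars (guard M s s')"
  then have "a \<in> avail M s - {Idle}" using assms(1,2) M unfolding is_hdmas_def by blast
  then show "v a = w a" by (rule assms(3))
qed

lemma profile_add_Idle:
  assumes "s \<in> states M" "profile M s C f"
  shows "profile M s (C + k) (f(Idle := f Idle + k))"
proof -
  have "sum (f(Idle := f Idle + k)) (avail M s)
      = (f Idle + k) + sum (f(Idle := f Idle + k)) (avail M s - {Idle})"
    using sum.remove[OF finite_avail Idle_avail] assms(1) by (metis fun_upd_same)
  also have "sum (f(Idle := f Idle + k)) (avail M s - {Idle}) = sum f (avail M s - {Idle})"
    by (intro sum.cong) auto
  also have "f Idle + k + sum f (avail M s - {Idle}) = sum f (avail M s) + k"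
    using sum.remove[OF finite_avail Idle_avail, of s f] assms(1) by simp
  finally show ?thesis
    using assms Idle_avail by (auto simp: profile_def)
qed

text \<open>All \<open>C\<close> agents may idle.\<close>

lemma profile_ex: "s \<in> states M \<Longrightarrow> \<exists>f. profile M s C f"
  using profile_add_Idle[of s 0 "\<lambda>_. 0" C] by (auto simp: profile_def)

lemma succs_subset: "succs M s f N \<subseteq> states M"
  by (auto simp: succs_def)

lemma succs_nonempty:
  assumes "s \<in> states M"
  shows "succs M s f N \<noteq> {}"
proof -
  obtain g where "profile M s N g" using profile_ex assms by blast
  then show ?thesis
    using guard_ex1[OF assms, of "\<lambda>a. f a + g a"] by (auto simp: succs_def)
qed

text \<open>The right-hand side has the shape of the matrix of \<open>prf_fm\<close>: every reply of
  the opponents satisfies a disjunction of guards. The equivalence rests on exactly one guard being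
  true for each assignment.\<close>

lemma succs_subset_iff:
  assumes "s \<in> states M" "X \<subseteq> states M"
  shows "succs M s f N \<subseteq> X \<longleftrightarrow>
    (\<forall>g. profile M s N g \<longrightarrow> (\<exists>s'\<in>X. qeval (\<lambda>a. f a + g a) (guard M s s')))"
proof
  assume X: "succs M s f N \<subseteq> X"
  show "\<forall>g. profile M s N g \<longrightarrow> (\<exists>s'\<in>X. qeval (\<lambda>a. f a + g a) (guard M s s'))"
  proof (intro allI impI)
    fix g assume g: "profile M s N g"
    obtain s' where s': "s' \<in> states M" "qeval (\<lambda>a. f a + g a) (guard M s s')"
      using guard_ex1[OF assms(1), of "\<lambda>a. f a + g a"] by auto
    then have "s' \<in> X" using X g by (auto simp: succs_def)
    then show "\<exists>s'\<in>X. qeval (\<lambda>a. f a + g a) (guard M s s')" using s' by blast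
  qed
next
  assume X: "\<forall>g. profile M s N g \<longrightarrow> (\<exists>s'\<in>X. qeval (\<lambda>a. f a + g a) (guard M s s'))"
  show "succs M s f N \<subseteq> X"
  proof
    fix s' assume "s' \<in> succs M s f N"
    then obtain g where g: "s' \<in> states M" "profile M s N g" "qeval (\<lambda>a. f a + g a) (guard M s s')"
      by (auto simp: succs_def)
    then obtain s'' where "s'' \<in> X" "qeval (\<lambda>a. f a + g a) (guard M s s'')" using X by blast
    then show "s' \<in> X" using guard_ex1[OF assms(1), of "\<lambda>a. f a + g a"] g assms(2) by blast
  qed
qed

text \<open>An additional agent may always idle, which no guard notices.\<close>

lemma succs_add_Idle:
  assumes "s \<in> states M"
  shows "succs M s (f(Idle := n)) N = succs M s f N"
proof -
  have "qeval (\<lambda>a. (f(Idle := n)) a + g a) (guard M s s') = qeval (\<lambda>a. f a + g a) (guard M s s')"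
    if "s' \<in> states M" for g s'
    using assms that by (intro guard_cong) auto
  then show ?thesis by (auto simp: succs_def)
qed

lemma succs_mono:
  assumes "s \<in> states M" "N \<le> N'"
  shows "succs M s f N \<subseteq> succs M s f N'"
proof
  fix s' assume s': "s' \<in> succs M s f N"
  then obtain g where g: "s' \<in> states M" "profile M s N g" "qeval (\<lambda>a. f a + g a) (guard M s s')"
    by (auto simp: succs_def)
  let ?g = "g(Idle := g Idle + (N' - N))"
  have "profile M s N' ?g"
    using profile_add_Idle[OF assms(1) g(2), of "N' - N"] assms(2) by simp
  moreover have "qeval (\<lambda>a. f a + ?g a) (guard M s s')"
    using g guard_cong[OF assms(1) g(1), of "\<lambda>a. f a + ?g a" "\<lambda>a. f a + g a"] by simp
  ultimately show "s' \<in> succs M s f N'" using g(1) unfolding succs_def by blast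
qed

lemma cpre_mono: "C \<le> C' \<Longrightarrow> N' \<le> N \<Longrightarrow> cpre M C N X \<subseteq> cpre M C' N' X"
proof
  fix s assume le: "C \<le> C'" "N' \<le> N" and "s \<in> cpre M C N X"
  then obtain f where s: "s \<in> states M" and f: "profile M s C f" "succs M s f N \<subseteq> X"
    by (auto simp: cpre_def)
  have "profile M s C' (f(Idle := f Idle + (C' - C)))"
    using profile_add_Idle[OF s f(1), of "C' - C"] le by simp
  moreover have "succs M s (f(Idle := f Idle + (C' - C))) N' \<subseteq> X"
    using succs_add_Idle[OF s] succs_mono[OF s le(2)] f(2) by blast
  ultimately show "s \<in> cpre M C' N' X" using s by (auto simp: cpre_def)
qed

lemma mono_cpre: "mono (cpre M C N)"
  by (auto simp: mono_def cpre_def)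

text \<open>The image of \<open>{}\<close> is empty because every choice of actions has a successor.
  All of \<open>states M\<close> is preserved because a profile exists at every state. Only
  \<open>X \<inter> states M\<close> matters because successors are states.\<close>

lemma cpre_preimage_fns: "cpre M C N \<in> preimage_fns (states M)"
  using mono_cpre succs_subset succs_nonempty profile_ex
  by (auto simp: preimage_fns_def cpre_def)

text \<open>Opponents whose reply depends only on the current state. This yields the existence of
  plays and, for U, a spoiling play.\<close>

lemma outcome_play_iterate:
  assumes \<sigma>: "\<And>s. s \<in> states M \<Longrightarrow> nxt s \<in> succs M s (\<sigma> s) N" and s: "s \<in> states M"
  shows "outcome_play M \<sigma> N s (\<lambda>i. (nxt ^^ i) s)"
proof -
  have "(nxt ^^ i) s \<in> states M" for i
    using s \<sigma> succs_subset by (induction i) (auto dest!: subsetD)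
  then show ?thesis using \<sigma> by (auto simp: outcome_play_iff_succs)
qed

section \<open>Plays and residual goals\<close>

lemma outcome_play_states:
  assumes "outcome_play M \<sigma> N s \<pi>" "s \<in> states M"
  shows "\<pi> i \<in> states M"
  using assms by (cases i) (auto simp: outcome_play_def)

lemma outcome_play_Cons:
  assumes "outcome_play M \<sigma> N s' \<pi>" "s' \<in> succs M s (\<sigma> s) N"
  shows "outcome_play M \<sigma> N s (case_nat s \<pi>)"
  using assms by (auto simp: outcome_play_iff_succs split: nat.split)

text \<open>Satisfaction and membership in an \<open>extension\<close> coincide only at states of
  \<open>M\<close>, so goals are compared only on plays through such states.\<close>

lemma win_cong:
  assumes "\<And>\<pi>. (\<And>i. \<pi> i \<in> states M) \<Longrightarrow> P \<pi> = R \<pi>"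
  shows "win M C N P = win M C N R"
  using assms outcome_play_states unfolding win_def by (metis (no_types, lifting))

text \<open>Strategies are positional: the witness for \<open>s\<close> also serves from each
  successor, for the goal that is read with \<open>s\<close> prepended to the play.\<close>

lemma win_witness:
  assumes "s \<in> win M C N P"
  obtains \<sigma> where "joint_strategy M C \<sigma>" "\<And>\<pi>. outcome_play M \<sigma> N s \<pi> \<Longrightarrow> P \<pi>"
    "\<And>s'. s' \<in> succs M s (\<sigma> s) N \<Longrightarrow> s' \<in> win M C N (\<lambda>\<pi>. P (case_nat s \<pi>))"
proof -
  obtain \<sigma> where \<sigma>: "joint_strategy M C \<sigma>" "\<And>\<pi>. outcome_play M \<sigma> N s \<pi> \<Longrightarrow> P \<pi>"
    using assms by (auto simp: win_def)
  moreover have "s' \<in> win M C N (\<lambda>\<pi>. P (case_nat s \<pi>))" if "s' \<in> succs M s (\<sigma> s) N" for s'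
    using that \<sigma> outcome_play_Cons[of \<sigma> N s' _ s] subsetD[OF succs_subset that]
    by (auto simp: win_def)
  ultimately show thesis by (rule that)
qed

lemma outcome_play_exists:
  assumes "s \<in> states M"
  obtains \<pi> where "outcome_play M \<sigma> N s \<pi>"
proof -
  have "(SOME s'. s' \<in> succs M s (\<sigma> s) N) \<in> succs M s (\<sigma> s) N" if "s \<in> states M" for s
    using succs_nonempty[OF that] by (simp add: some_in_eq)
  from outcome_play_iterate[of _ \<sigma>, OF this assms] show thesis by (rule that)
qed

text \<open>Local choices are glued to one positional strategy. States outside \<open>R\<close>
  receive an arbitrary profile, since a joint strategy must be legal at every state.\<close>

lemma joint_strategy_choice:
  assumes "\<And>s. s \<in> states M \<Longrightarrow> R s \<Longrightarrow> \<exists>f. profile M s C f \<and> P s f"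
  obtains \<sigma> where "joint_strategy M C \<sigma>" "\<And>s. s \<in> states M \<Longrightarrow> R s \<Longrightarrow> P s (\<sigma> s)"
proof -
  have "\<forall>s. \<exists>f. s \<in> states M \<longrightarrow> profile M s C f \<and> (R s \<longrightarrow> P s f)"
    using assms profile_ex by blast
  then obtain \<sigma> where "\<forall>s. s \<in> states M \<longrightarrow> profile M s C (\<sigma> s) \<and> (R s \<longrightarrow> P s (\<sigma> s))"
    by metis
  then show thesis using that[of \<sigma>] by (auto simp: joint_strategy_def)
qed

section \<open>Winning regions of X, G and U through the controllable preimage\<close>

lemma win_next: "win M C N (\<lambda>\<pi>. \<pi> 1 \<in> Q) = cpre M C N Q"
proof (intro set_eqI iffI)
  fix s assume s: "s \<in> win M C N (\<lambda>\<pi>. \<pi> 1 \<in> Q)"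
  from s obtain \<sigma> where \<sigma>: "joint_strategy M C \<sigma>"
    "\<And>s'. s' \<in> succs M s (\<sigma> s) N \<Longrightarrow> s' \<in> win M C N (\<lambda>\<pi>. \<pi> 0 \<in> Q)"
    by (rule win_witness) simp
  have "s' \<in> Q" if s': "s' \<in> succs M s (\<sigma> s) N" for s'
  proof -
    obtain \<tau> where "s' \<in> states M" "\<And>\<pi>. outcome_play M \<tau> N s' \<pi> \<Longrightarrow> \<pi> 0 \<in> Q"
      using \<sigma>(2)[OF s'] by (auto simp: win_def)
    \<comment> \<open>The goal on position 0 says something about \<open>s'\<close> only because
      some play starts there.\<close>
    then show ?thesis
      using outcome_play_exists[of s' \<tau> N] by (auto simp: outcome_play_def)
  qed
  then show "s \<in> cpre M C N Q"
    using s \<sigma>(1) by (auto simp: cpre_def win_def joint_strategy_def)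
next
  fix s assume s: "s \<in> cpre M C N Q"
  obtain \<sigma> where "joint_strategy M C \<sigma>"
    "\<And>t. t \<in> states M \<Longrightarrow> t = s \<Longrightarrow> succs M t (\<sigma> t) N \<subseteq> Q"
    using joint_strategy_choice[of "\<lambda>t. t = s" C "\<lambda>t f. succs M t f N \<subseteq> Q"] s
    by (auto simp: cpre_def)
  then show "s \<in> win M C N (\<lambda>\<pi>. \<pi> 1 \<in> Q)"
    using s by (fastforce simp: win_def cpre_def outcome_play_iff_succs)
qed

text \<open>The winning region is a post-fixpoint, as the residual goal at each successor is again
  the same goal. Conversely, one profile per state of the fixpoint that keeps all successors inside
  it forms a positional strategy that never leaves it.\<close>

lemma win_globally: "win M C N (\<lambda>\<pi>. \<forall>i. \<pi> i \<in> Q) = gfp (\<lambda>X. cpre M C N X \<inter> Q)"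
  (is "?V = gfp ?F")
proof
  have mono: "mono ?F" using mono_cpre unfolding mono_def by blast
  have "?V \<subseteq> ?F ?V"
  proof
    fix s assume s: "s \<in> ?V"
    from s obtain \<sigma> where \<sigma>: "joint_strategy M C \<sigma>"
        "\<And>\<pi>. outcome_play M \<sigma> N s \<pi> \<Longrightarrow> \<forall>i. \<pi> i \<in> Q"
        "\<And>s'. s' \<in> succs M s (\<sigma> s) N \<Longrightarrow> s' \<in> win M C N (\<lambda>\<pi>. \<forall>i. case_nat s \<pi> i \<in> Q)"
      by (rule win_witness) blast
    have sS: "s \<in> states M" using s by (simp add: win_def)
    then obtain \<pi> where "outcome_play M \<sigma> N s \<pi>" by (rule outcome_play_exists)
    then have "s \<in> Q" using \<sigma>(2) by (metis outcome_play_def)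
    moreover have "win M C N (\<lambda>\<pi>. \<forall>i. case_nat s \<pi> i \<in> Q) \<subseteq> ?V"
      unfolding win_def by (auto dest!: spec[of _ "Suc _"]) (metis nat.case(2))
    then have "succs M s (\<sigma> s) N \<subseteq> ?V" using \<sigma>(3) by blast
    ultimately show "s \<in> ?F ?V"
      using sS \<sigma>(1) by (auto simp: cpre_def joint_strategy_def)
  qed
  then show "?V \<subseteq> gfp ?F" by (rule gfp_upperbound)
  let ?G = "gfp ?F"
  have G: "?G = cpre M C N ?G \<inter> Q" by (rule gfp_unfold[OF mono])
  obtain \<sigma> where \<sigma>: "joint_strategy M C \<sigma>"
    "\<And>s. s \<in> states M \<Longrightarrow> s \<in> ?G \<Longrightarrow> succs M s (\<sigma> s) N \<subseteq> ?G"
  proof (rule joint_strategy_choice[of "\<lambda>s. s \<in> ?G" C "\<lambda>s f. succs M s f N \<subseteq> ?G"])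
    fix s assume "s \<in> ?G"
    then have "s \<in> cpre M C N ?G" using G by blast
    then show "\<exists>f. profile M s C f \<and> succs M s f N \<subseteq> ?G" by (simp add: cpre_def)
  qed blast
  show "?G \<subseteq> ?V"
  proof
    fix s assume s: "s \<in> ?G"
    have GS: "?G \<subseteq> states M" using G by (auto simp: cpre_def)
    have "\<pi> i \<in> ?G" if "outcome_play M \<sigma> N s \<pi>" for \<pi> i
      by (induction i) (use that s \<sigma>(2) GS in \<open>auto simp: outcome_play_iff_succs\<close>)
    then show "s \<in> ?V" using \<sigma>(1) s G GS by (fastforce simp: win_def)
  qed
qed

text \<open>Outside the least fixpoint the opponents can avoid it as long as the play stays in
  \<open>Q1\<close>, hence they avoid \<open>Q2\<close>. Inside, a positional strategy must make
  progress, which the stage at which a state enters the iteration measures.\<close>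

lemma win_until:
  assumes Q2: "Q2 \<subseteq> states M" and fin: "finite (states M)"
  shows "win M C N (\<lambda>\<pi>. \<exists>i. \<pi> i \<in> Q2 \<and> (\<forall>j<i. \<pi> j \<in> Q1)) = lfp (\<lambda>X. Q2 \<union> (cpre M C N X \<inter> Q1))"
  (is "?V = lfp ?F")
proof
  have mono: "mono ?F" using mono_cpre unfolding mono_def by blast
  let ?L = "lfp ?F"
  have L: "?L = Q2 \<union> (cpre M C N ?L \<inter> Q1)" by (rule lfp_unfold[OF mono])
  show "?V \<subseteq> ?L"
  proof (rule subsetI, rule ccontr)
    fix s assume s: "s \<in> ?V" "s \<notin> ?L"
    obtain \<sigma> where \<sigma>: "joint_strategy M C \<sigma>"
        "\<And>\<pi>. outcome_play M \<sigma> N s \<pi> \<Longrightarrow> \<exists>i. \<pi> i \<in> Q2 \<and> (\<forall>j<i. \<pi> j \<in> Q1)"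
      using s(1) by (auto simp: win_def)
    \<comment> \<open>The spoiling reply leaves the fixpoint alone whenever possible. If it still
      enters, all successors are inside, and a state of \<open>Q1\<close> would itself belong to the
      fixpoint.\<close>
    define nxt where "nxt t = (SOME t'. t' \<in> succs M t (\<sigma> t) N \<and>
        (t' \<in> ?L \<longrightarrow> succs M t (\<sigma> t) N \<subseteq> ?L))" for t
    have nxt: "nxt t \<in> succs M t (\<sigma> t) N \<and> (nxt t \<in> ?L \<longrightarrow> succs M t (\<sigma> t) N \<subseteq> ?L)"
      if "t \<in> states M" for t
      unfolding nxt_def by (rule someI_ex) (use succs_nonempty[OF that] in blast)
    let ?\<pi> = "\<lambda>i. (nxt ^^ i) s"
    have sS: "s \<in> states M" using s by (simp add: win_def)
    have play: "outcome_play M \<sigma> N s ?\<pi>"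
      by (rule outcome_play_iterate) (use nxt sS in auto)
    then obtain i where i: "?\<pi> i \<in> Q2" "\<And>j. j < i \<Longrightarrow> ?\<pi> j \<in> Q1" using \<sigma>(2) by blast
    have "j \<le> i \<longrightarrow> ?\<pi> j \<notin> ?L" for j
    proof (induction j)
      case 0
      then show ?case using s by simp
    next
      case (Suc j)
      show ?case
      proof (rule impI, rule notI)
        assume le: "Suc j \<le> i" and "?\<pi> (Suc j) \<in> ?L"
        have \<pi>S: "?\<pi> j \<in> states M" using outcome_play_states[OF play sS] .
        have "succs M (?\<pi> j) (\<sigma> (?\<pi> j)) N \<subseteq> ?L"
          using nxt[OF \<pi>S] \<open>?\<pi> (Suc j) \<in> ?L\<close> by simp
        then have "?\<pi> j \<in> cpre M C N ?L"
          using \<sigma>(1) \<pi>S by (auto simp: cpre_def joint_strategy_def)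
        then have "?\<pi> j \<in> ?L" using L i(2)[of j] le by auto
        then show False using Suc le by simp
      qed
    qed
    then have "?\<pi> i \<notin> ?L" by blast
    then show False using L i(1) by blast
  qed
  define A where "A n = (?F ^^ n) {}" for n
  have A_Suc: "A (Suc n) = Q2 \<union> (cpre M C N (A n) \<inter> Q1)" for n by (simp add: A_def)
  \<comment> \<open>The profile at a state may depend only on the state, so the least stage is used.
    The shift by one records that stage 0 is empty: a state outside \<open>Q2\<close> enters at
    \<open>Suc (rank s)\<close>, with its successors forced into stage
    \<open>rank s\<close>.\<close>
  define rank where "rank s = (LEAST n. s \<in> A (Suc n))" for s
  have rank: "s \<in> A (Suc (rank s))" "rank s \<le> n" if "s \<in> A (Suc n)" for s n
    unfolding rank_def using that by (auto intro: LeastI Least_le)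
  have A_S: "A n \<subseteq> states M" for n
    using Q2 by (cases n) (auto simp: A_Suc cpre_def, simp add: A_def)
  obtain \<sigma> where \<sigma>: "joint_strategy M C \<sigma>"
    "\<And>s. s \<in> states M \<Longrightarrow> s \<notin> Q2 \<and> (\<exists>n. s \<in> A (Suc n)) \<Longrightarrow> succs M s (\<sigma> s) N \<subseteq> A (rank s)"
  proof (rule joint_strategy_choice[of "\<lambda>s. s \<notin> Q2 \<and> (\<exists>n. s \<in> A (Suc n))" C
        "\<lambda>s f. succs M s f N \<subseteq> A (rank s)"])
    fix s assume "s \<notin> Q2 \<and> (\<exists>n. s \<in> A (Suc n))"
    then have "s \<in> cpre M C N (A (rank s))" using rank(1) A_Suc by blast
    then show "\<exists>f. profile M s C f \<and> succs M s f N \<subseteq> A (rank s)" by (simp add: cpre_def)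
  qed blast
  let ?P = "\<lambda>\<pi>. \<exists>i. \<pi> i \<in> Q2 \<and> (\<forall>j<i. \<pi> j \<in> Q1)"
  have reach: "?P \<pi>" if "s \<in> A n" "outcome_play M \<sigma> N s \<pi>" for s n \<pi>
    using that
  proof (induction n arbitrary: s \<pi> rule: less_induct)
    case (less n)
    then have sS: "s \<in> states M" using A_S by blast
    have \<pi>0: "\<pi> 0 = s" using less.prems by (simp add: outcome_play_def)
    show ?case
    proof (cases "s \<in> Q2")
      case True
      then show ?thesis using \<pi>0 by (intro exI[of _ 0]) simp
    next
      case False
      obtain m where m: "n = Suc m" using less.prems(1) by (cases n) (auto simp: A_def)
      have "\<pi> 1 \<in> succs M s (\<sigma> s) N"
        using less.prems(2) \<pi>0 by (metis One_nat_def outcome_play_iff_succs)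
      then have "\<pi> 1 \<in> A (rank s)" using \<sigma>(2)[OF sS] False less.prems(1) m by blast
      \<comment> \<open>The given stage \<open>n\<close> may be larger than necessary, while the
        strategy aims at stage \<open>rank s\<close>; hence the complete induction.\<close>
      moreover have "rank s < n" using rank(2) less.prems(1) m by fastforce
      moreover have "outcome_play M \<sigma> N (\<pi> 1) (\<lambda>i. \<pi> (Suc i))"
        using less.prems(2) by (simp add: outcome_play_iff_succs)
      ultimately obtain i where i: "\<pi> (Suc i) \<in> Q2" "\<And>j. j < i \<Longrightarrow> \<pi> (Suc j) \<in> Q1"
        using less.IH[of "rank s" "\<pi> 1" "\<lambda>i. \<pi> (Suc i)"] by blast
      have "s \<in> Q1" using less.prems(1) m False A_Suc by blast
      then have "\<forall>j<Suc i. \<pi> j \<in> Q1" using i(2) \<pi>0 by (auto simp: less_Suc_eq_0_disj)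
      then show ?thesis using i(1) by blast
    qed
  qed
  have AV: "A n \<subseteq> ?V" for n
    using reach A_S \<sigma>(1) unfolding win_def by blast
  have "mono A" unfolding A_def using mono_funpow[OF mono] by simp
  moreover have "finite (range A)"
    by (rule finite_subset[of _ "Pow (states M)"]) (use A_S fin in auto)
  \<comment> \<open>The stages increase within a finite power set, so some stage is closed under the
    operator and contains the least fixpoint.\<close>
  ultimately obtain n where "(SUP n. A n) = A n" by (rule SUP_attained)
  then have "A (Suc n) \<subseteq> A n" by blast
  then have "?L \<subseteq> A n" by (intro lfp_lowerbound) (simp add: A_def)
  then show "?L \<subseteq> ?V" using AV by blast
qed

end


section \<open>Evaluating the Presburger formulas\<close>

lemma qeval_qsubst: "qeval e (qsubst \<sigma> f) = qeval (\<lambda>v. teval e (\<sigma> v)) f"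
proof -
  have "teval e (tsubst \<sigma> t) = teval (\<lambda>v. teval e (\<sigma> v)) t" for t :: "'b pterm"
    by (induction t) auto
  then show ?thesis by (induction f) auto
qed

lemma qeval_QAnds: "qeval e (QAnds fs) \<longleftrightarrow> (\<forall>f\<in>set fs. qeval e f)"
  unfolding QAnds_def by (induction fs) auto

lemma qeval_QOrs: "qeval e (QOrs fs) \<longleftrightarrow> (\<exists>f\<in>set fs. qeval e f)"
  unfolding QOrs_def by (induction fs) auto

lemma teval_PSum: "teval e (PSum ts) = sum_list (map (teval e) ts)"
  unfolding PSum_def by (induction ts) auto

section \<open>Blocks of quantifiers over counters\<close>

lemma override_on_insert_upd:
  "override_on (e(x := h x)) h V = override_on e h (insert x V)"
  by (auto simp: override_on_def)

lemma override_on_upd: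
  "override_on (e(x := n)) h V = override_on e (if x \<in> V then h else h(x := n)) (insert x V)"
  by (auto simp: override_on_def)

text \<open>A block becomes a single quantifier over a function. Since the variables
  \<open>K a\<close> and \<open>L a\<close> are disjoint, the values of both blocks can be read off
  two nested overrides.\<close>

lemma peval_PExs:
  "peval e (foldr (\<lambda>a. PEx (c a)) as f) \<longleftrightarrow> (\<exists>h. peval (override_on e h (c ` set as)) f)"
proof (induction as arbitrary: e)
  case (Cons a as)
  have "(\<exists>n h. peval (override_on (e(c a := n)) h (c ` set as)) f) \<longleftrightarrow>
      (\<exists>h. peval (override_on e h (insert (c a) (c ` set as))) f)"
    by (metis override_on_insert_upd override_on_upd)
  then show ?case using Cons.IH by (simp del: fun_upd_apply)
qed simp

lemma peval_PAlls:
  "peval e (foldr (\<lambda>a. PAll (c a)) as f) \<longleftrightarrow> (\<forall>h. peval (override_on e h (c ` set as)) f)"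
proof (induction as arbitrary: e)
  case (Cons a as)
  have "(\<forall>n h. peval (override_on (e(c a := n)) h (c ` set as)) f) \<longleftrightarrow>
      (\<forall>h. peval (override_on e h (insert (c a) (c ` set as))) f)"
    by (metis override_on_insert_upd override_on_upd)
  then show ?case using Cons.IH by (simp del: fun_upd_apply)
qed simp

lemma set_enum_of:
  assumes "finite A"
  shows "set (enum_of A) = A"
  using someI_ex[OF finite_distinct_list[OF assms]] by (simp add: enum_of_def)

lemma teval_override_on:
  assumes "pvars t \<inter> V = {}"
  shows "teval (override_on e h V) t = teval e t"
  using assms by (intro teval_cong) (auto simp: override_on_def)

text \<open>An environment is arbitrary at counters of non-actions; the default 0 meets the
  convention of \<open>profile\<close>.\<close>

definition counts :: "('ag, 's, 'p) hdmas \<Rightarrow> (act \<Rightarrow> mcvar) \<Rightarrow> (mcvar \<Rightarrow> nat) \<Rightarrow> act \<Rightarrow> nat" where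
  "counts M c e a = (if a \<in> set (all_acts M) then e (c a) else 0)"

context
  fixes M :: "('ag, 's, 'p) hdmas"
  assumes M: "is_hdmas M"
begin

lemma qeval_action_cond:
  assumes "s \<in> states M"
  shows "qeval e (action_cond M s c t) \<longleftrightarrow> profile M s (teval e t) (counts M c e)"
proof -
  have "qeval e (action_cond M s c t) \<longleftrightarrow>
      (\<forall>a\<in>set (real_acts M). e (c a) \<noteq> 0 \<longrightarrow> a \<in> avail M s) \<and>
      (\<Sum>a\<leftarrow>all_acts M. e (c a)) = teval e t"
    by (auto simp: action_cond_def qeval_QAnds teval_PSum comp_def)
  \<comment> \<open>The formula has no availability condition for \<open>Idle\<close>, which is
    available everywhere.\<close>
  also have "(\<forall>a\<in>set (real_acts M). e (c a) \<noteq> 0 \<longrightarrow> a \<in> avail M s) \<longleftrightarrow>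
      (\<forall>a. a \<notin> avail M s \<longrightarrow> counts M c e a = 0)"
    using Idle_avail[OF M assms] by (auto simp: counts_def set_all_acts)
  also have "(\<Sum>a\<leftarrow>all_acts M. e (c a)) = (\<Sum>a\<in>set (all_acts M). counts M c e a)"
    by (simp add: sum_list_distinct_conv_sum_set distinct_all_acts counts_def)
  finally have "qeval e (action_cond M s c t) \<longleftrightarrow>
      (\<forall>a. a \<notin> avail M s \<longrightarrow> counts M c e a = 0) \<and>
      (\<Sum>a\<in>set (all_acts M). counts M c e a) = teval e t" .
  moreover have "(\<Sum>a\<in>set (all_acts M). counts M c e a) = sum (counts M c e) (avail M s)"
    if "\<forall>a. a \<notin> avail M s \<longrightarrow> counts M c e a = 0"
    using that avail_subset[OF M assms] by (intro sum.mono_neutral_right) auto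
  ultimately show ?thesis by (auto simp: profile_def)
qed

lemma counts_surj:
  assumes "s \<in> states M" "profile M s C f" "inj c"
  shows "counts M c (f \<circ> inv c) = f"
  using assms avail_subset[OF M assms(1)] by (auto simp: counts_def profile_def fun_eq_iff)

text \<open>Every profile is the reading of some environment, so quantified counters range over
  exactly the profiles.\<close>

lemma ex_counts_iff:
  assumes "s \<in> states M" "inj c"
  shows "(\<exists>h. profile M s C (counts M c h) \<and> R (counts M c h)) \<longleftrightarrow> (\<exists>f. profile M s C f \<and> R f)"
proof
  assume "\<exists>f. profile M s C f \<and> R f"
  then obtain f where f: "profile M s C f" "R f" by blast
  then show "\<exists>h. profile M s C (counts M c h) \<and> R (counts M c h)"
    using counts_surj[OF assms(1) f(1) assms(2)] by (intro exI[of _ "f \<circ> inv c"]) simp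
qed blast

lemma all_counts_iff:
  assumes "s \<in> states M" "inj c"
  shows "(\<forall>h. profile M s C (counts M c h) \<longrightarrow> R (counts M c h)) \<longleftrightarrow> (\<forall>f. profile M s C f \<longrightarrow> R f)"
  using ex_counts_iff[OF assms, of C "\<lambda>f. \<not> R f"] by blast

text \<open>The terms may contain only variables \<open>PY y\<close>; hence the blocks over
  \<open>K a\<close> and \<open>L a\<close> do not capture anything in them and leave their values
  unchanged.\<close>

lemma peval_prf_fm:
  assumes s: "s \<in> states M" and Q: "Q \<subseteq> states M" "finite Q"
    and t: "pvars t1 \<subseteq> range PY" "pvars t2 \<subseteq> range PY"
  shows "peval e (prf_fm M s t1 t2 Q) \<longleftrightarrow> s \<in> cpre M (teval e t1) (teval e t2) Q"
proof -
  let ?A = "set (all_acts M)"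
  let ?e1 = "\<lambda>h. override_on e h (K ` ?A)" and ?e2 = "\<lambda>h h'. override_on (override_on e h (K ` ?A)) h' (L ` ?A)"
  have inj: "inj K" "inj L" by (auto intro: injI)
  have cK: "counts M K (?e1 h) = counts M K h" "counts M K (?e2 h h') = counts M K h" for h h'
    by (auto simp: counts_def override_on_def fun_eq_iff)
  have cL: "counts M L (?e2 h h') = counts M L h'" for h h'
    by (auto simp: counts_def override_on_def fun_eq_iff)
  have t1: "teval (?e1 h) t1 = teval e t1" for h
    using t(1) by (intro teval_override_on) auto
  have t2: "teval (?e2 h h') t2 = teval e t2" for h h'
    using t(2) by (subst teval_override_on, force)+ simp
  have grd: "qeval (?e2 h h') (qsubst (\<lambda>a. PAdd (PVar (K a)) (PVar (L a))) (grd M s Q)) \<longleftrightarrow>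
      (\<exists>s'\<in>Q. qeval (\<lambda>a. counts M K h a + counts M L h' a) (guard M s s'))" for h h'
  proof -
    \<comment> \<open>Outside the actions of \<open>M\<close> the environment and
      \<open>counts\<close> may differ, but guards read only available actions.\<close>
    have "qeval (\<lambda>a. ?e2 h h' (K a) + ?e2 h h' (L a)) (guard M s s') =
        qeval (\<lambda>a. counts M K h a + counts M L h' a) (guard M s s')" if "s' \<in> Q" for s'
    proof (rule guard_cong[OF M s])
      show "s' \<in> states M" using that Q by blast
      fix a assume "a \<in> avail M s - {Idle}"
      then have "a \<in> ?A" using avail_subset[OF M s] by blast
      then show "?e2 h h' (K a) + ?e2 h h' (L a) = counts M K h a + counts M L h' a"
        by (auto simp: counts_def override_on_def)
    qed
    then show ?thesis
      by (auto simp: qeval_qsubst grd_def qeval_QOrs set_enum_of[OF Q(2)])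
  qed
  have "peval e (prf_fm M s t1 t2 Q) \<longleftrightarrow>
      (\<exists>h. profile M s (teval e t1) (counts M K h) \<and>
        (\<forall>h'. profile M s (teval e t2) (counts M L h') \<longrightarrow>
          (\<exists>s'\<in>Q. qeval (\<lambda>a. counts M K h a + counts M L h' a) (guard M s s'))))"
    unfolding prf_fm_def peval_PExs peval.simps peval_PAlls qeval_action_cond[OF s]
      cK cL t1 t2 grd ..
  also have "\<dots> \<longleftrightarrow> (\<exists>h. profile M s (teval e t1) (counts M K h) \<and>
      succs M s (counts M K h) (teval e t2) \<subseteq> Q)"
    unfolding succs_subset_iff[OF M s Q(1)]
    by (subst all_counts_iff[OF s inj(2)]) (rule refl)
  also have "\<dots> \<longleftrightarrow> (\<exists>f. profile M s (teval e t1) f \<and> succs M s f (teval e t2) \<subseteq> Q)"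
    by (rule ex_counts_iff[OF s inj(1)])
  also have "\<dots> \<longleftrightarrow> s \<in> cpre M (teval e t1) (teval e t2) Q"
    using s by (simp add: cpre_def)
  finally show ?thesis .
qed

text \<open>The mixed assignment reads the variables in \<open>V\<close> from the environment and
  everything else from \<open>\<theta>\<close>, so updating \<open>PY y\<close> in one amounts to
  updating \<open>Y y\<close> in the other. \<open>V\<close> stays fixed while the prefix gets
  shorter in the induction, hence the inclusion.\<close>

lemma peval_close:
  assumes "\<And>e. peval e f \<longleftrightarrow> s \<in> A (\<lambda>t. if t \<in> Y ` V then e (PY (inv Y t)) else \<theta> t)"
    and "qvar ` set qs \<subseteq> V"
  shows "peval e (close qs f) \<longleftrightarrow>
    s \<in> interp qs A (\<lambda>t. if t \<in> Y ` V then e (PY (inv Y t)) else \<theta> t)"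
  using assms(2)
proof (induction qs arbitrary: e)
  case Nil
  then show ?case using assms(1) by simp
next
  case (Cons q qs)
  have inj: "inj Y" by (auto intro: injI)
  have "(\<lambda>t. if t \<in> Y ` V then (e(PY y := n)) (PY (inv Y t)) else \<theta> t) =
      (\<lambda>t. if t \<in> Y ` V then e (PY (inv Y t)) else \<theta> t)(Y y := n)" if "y \<in> V" for y n
    using that by (auto simp: fun_eq_iff inj)
  then show ?case using Cons by (cases q) (auto simp del: fun_upd_apply)
qed

lemma preImg_eq_interp:
  assumes Q: "Q \<subseteq> states M" and fin: "finite (states M)"
  shows "preImg M t1 t2 Q \<theta> qs = interp qs (\<lambda>\<theta>. cpre M (\<theta> t1) (\<theta> t2) Q) \<theta>"
proof -
  let ?V = "qvar ` set qs"
  let ?e = "\<lambda>e t. if t \<in> Y ` ?V then e (PY (inv Y t)) else \<theta> t"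
  have inj: "inj Y" by (auto intro: injI)
  have V: "y \<in> ?V \<longleftrightarrow> AllQ y \<in> set qs \<or> ExQ y \<in> set qs" for y
    by (force split: quant.splits)
  \<comment> \<open>\<open>inst\<close> keeps exactly the variables of the prefix symbolic, so its
    value is given by the mixed assignment for \<open>?V\<close>.\<close>
  have inst: "teval e (inst \<theta> qs t) = ?e e t" "pvars (inst \<theta> qs t) \<subseteq> range PY" for e t
    by (cases t; auto simp: V[symmetric] inj image_iff)+
  let ?f = "\<lambda>s. prf_fm M s (inst \<theta> qs t1) (inst \<theta> qs t2) Q"
  have "peval e (close qs (?f s)) \<longleftrightarrow> s \<in> interp qs (\<lambda>\<theta>. cpre M (\<theta> t1) (\<theta> t2) Q) \<theta>"
    if s: "s \<in> states M" for e s
  proof -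
    have "peval e (?f s) \<longleftrightarrow> s \<in> cpre M (?e e t1) (?e e t2) Q" for e
      using peval_prf_fm[OF s Q finite_subset[OF Q fin] inst(2) inst(2)] by (simp only: inst(1))
    then have "peval e (close qs (?f s)) \<longleftrightarrow>
        s \<in> interp qs (\<lambda>\<theta>. cpre M (\<theta> t1) (\<theta> t2) Q) (?e e)"
      by (rule peval_close) simp
    also have "interp qs (\<lambda>\<theta>. cpre M (\<theta> t1) (\<theta> t2) Q) (?e e) =
        interp qs (\<lambda>\<theta>. cpre M (\<theta> t1) (\<theta> t2) Q) \<theta>"
      by (rule interp_agree) auto
    finally show ?thesis .
  qed
  moreover have "interp qs (\<lambda>\<theta>. cpre M (\<theta> t1) (\<theta> t2) Q) \<theta> \<subseteq> states M"
    (is "interp qs ?B \<theta> \<subseteq> _")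
    by (induction qs ?B \<theta> rule: interp.induct) (auto simp: cpre_def)
  ultimately show ?thesis by (auto simp: preImg_def ptrue_def)
qed

text \<open>The syntactic restriction on terms lets y1 count only controlled agents and y2 only
  opponents, which determines the direction of each dependence.\<close>

lemma directed_cpre:
  assumes "t1 \<noteq> Y Y2" "t2 \<noteq> Y Y1"
  shows "directed_fns (states M) (\<lambda>\<theta>. cpre M (\<theta> t1) (\<theta> t2))"
  unfolding directed_fns_def
proof (intro conjI allI monoI antimonoI le_funI cpre_preimage_fns[OF M])
  fix \<theta> :: "trm \<Rightarrow> nat" and m n :: nat and X assume "m \<le> n"
  then show "cpre M ((\<theta>(Y Y1 := m)) t1) ((\<theta>(Y Y1 := m)) t2) X
      \<subseteq> cpre M ((\<theta>(Y Y1 := n)) t1) ((\<theta>(Y Y1 := n)) t2) X"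
    and "cpre M ((\<theta>(Y Y2 := n)) t1) ((\<theta>(Y Y2 := n)) t2) X
      \<subseteq> cpre M ((\<theta>(Y Y2 := m)) t1) ((\<theta>(Y Y2 := m)) t2) X"
    using assms by (intro cpre_mono[OF M]; simp)+
qed

end

section \<open>Independence of quantified variables\<close>

text \<open>In normal form, a bound variable used by a strategic operator has its quantifier among
  the two nearest ones directly in front of it. A variable bound further out, or separated by
  another operator, is never read before it is rebound; \<open>V\<close> collects such
  variables.\<close>

lemma sat_indep:
  shows "nf B qs \<phi> \<Longrightarrow> state_formula A \<phi> \<Longrightarrow> V \<subseteq> B \<Longrightarrow> V \<inter> qvar ` set (take 2 qs) = {} \<Longrightarrow>
      (\<And>t. t \<notin> Y ` V \<Longrightarrow> \<theta>' t = \<theta> t) \<Longrightarrow> sat M s \<theta>' \<phi> = sat M s \<theta> \<phi>"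
    and "nf_t B \<chi> \<Longrightarrow> temp_formula A \<chi> \<Longrightarrow> V \<subseteq> B \<Longrightarrow>
      (\<And>t. t \<notin> Y ` V \<Longrightarrow> \<theta>' t = \<theta> t) \<Longrightarrow> sat_play M \<pi> \<theta>' \<chi> = sat_play M \<pi> \<theta> \<chi>"
proof (induction B qs \<phi> and B \<chi> arbitrary: V \<theta> \<theta>' s and V \<theta> \<theta>' \<pi> rule: nf_nf_t.induct)
  case (6 B qs t1 t2 \<chi>)
  have set: "set (take 1 qs) \<subseteq> set (take 2 qs)" by (rule set_take_subset_set_take) simp
  have "t1 \<notin> Y ` V"
  proof
    assume "t1 \<in> Y ` V"
    moreover have "t1 \<noteq> Y Y2" using "6.prems"(2) by simp
    ultimately have Y1: "t1 = Y Y1" "Y1 \<in> V" by (auto, (metis yvar.exhaust)+)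
    then have "ExQ Y1 \<in> set (take 2 qs)"
      using "6.prems"(1,3) set by (auto simp: Let_def split: if_splits)
    then show False using "6.prems"(4) Y1(2) by force
  qed
  moreover have "t2 \<notin> Y ` V"
  proof
    assume "t2 \<in> Y ` V"
    moreover have "t2 \<noteq> Y Y1" using "6.prems"(2) by simp
    ultimately have Y2: "t2 = Y Y2" "Y2 \<in> V" by (auto, (metis yvar.exhaust)+)
    then have "AllQ Y2 \<in> set (take 2 qs)"
      using "6.prems"(1,3) set by (auto simp: Let_def split: if_splits)
    then show False using "6.prems"(4) Y2(2) by force
  qed
  ultimately have "\<theta>' t1 = \<theta> t1" "\<theta>' t2 = \<theta> t2" using "6.prems"(5) by auto
  moreover have "sat_play M \<pi> \<theta>' \<chi> = sat_play M \<pi> \<theta> \<chi>" for \<pi>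
    using "6.prems" by (intro "6.IH") auto
  ultimately show ?case by simp
next
  case (7 B qs y \<phi>)
  have "sat M s (\<theta>'(Y y := n)) \<phi> = sat M s (\<theta>(Y y := n)) \<phi>" for n
  \<comment> \<open>The new quantifier overwrites \<open>y\<close> and also makes it one of the two
    nearest, so \<open>y\<close> has to leave \<open>V\<close>.\<close>
  proof (rule "7.IH"[where V = "V - {y}"])
    show "(V - {y}) \<inter> qvar ` set (take 2 (AllQ y # qs)) = {}"
      using "7.prems"(4) set_take_subset_set_take[of 1 2 qs] by (auto simp: numeral_2_eq_2)
    show "(\<theta>'(Y y := n)) t = (\<theta>(Y y := n)) t" if "t \<notin> Y ` (V - {y})" for t
      using "7.prems"(5)[of t] that by (cases "t = Y y") auto
  qed (use "7.prems" in auto)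
  then show ?case by simp
next
  case (8 B qs y \<phi>)
  have "sat M s (\<theta>'(Y y := n)) \<phi> = sat M s (\<theta>(Y y := n)) \<phi>" for n
  proof (rule "8.IH"[where V = "V - {y}"])
    show "(V - {y}) \<inter> qvar ` set (take 2 (ExQ y # qs)) = {}"
      using "8.prems"(4) set_take_subset_set_take[of 1 2 qs] by (auto simp: numeral_2_eq_2)
    show "(\<theta>'(Y y := n)) t = (\<theta>(Y y := n)) t" if "t \<notin> Y ` (V - {y})" for t
      using "8.prems"(5)[of t] that by (cases "t = Y y") auto
  qed (use "8.prems" in auto)
  then show ?case by simp
next
  case (3 B qs \<phi>)
  show ?case using "3.IH"[of V \<theta>' \<theta> s] "3.prems" by simp
next
  case (4 B qs \<phi> \<psi>)
  show ?case using "4.IH"(1)[of V \<theta>' \<theta> s] "4.IH"(2)[of V \<theta>' \<theta> s] "4.prems" by simp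
next
  case (5 B qs \<phi> \<psi>)
  show ?case using "5.IH"(1)[of V \<theta>' \<theta> s] "5.IH"(2)[of V \<theta>' \<theta> s] "5.prems" by simp
next
  case (9 B \<phi>)
  show ?case using "9.IH"[of V \<theta>' \<theta>] "9.prems" by simp
next
  case (10 B \<phi>)
  show ?case using "10.IH"[of V \<theta>' \<theta>] "10.prems" by simp
next
  case (11 B \<phi> \<psi>)
  show ?case using "11.IH"(1)[of V \<theta>' \<theta>] "11.IH"(2)[of V \<theta>' \<theta>] "11.prems" by simp
qed simp_all

text \<open>A quantifier over \<open>y\<close> in front of \<open>\<phi>\<close> does not belong to a strategic prefix.\<close>

fun skippable :: "yvar \<Rightarrow> 'p sfm \<Rightarrow> bool" where
  "skippable y (Strat t1 t2 \<chi>) = False"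
| "skippable y (FAll y' (Strat t1 t2 \<chi>)) = (y' = y)"
| "skippable y (FEx y' (Strat t1 t2 \<chi>)) = (y' = y)"
| "skippable y \<phi> = True"

text \<open>\<open>sat_indep\<close> does not apply to \<open>\<phi>\<close> itself when
  \<open>q\<close> binds \<open>y\<close>, because \<open>y\<close> is then among the nearest
  quantifiers. It is applied below \<open>\<phi>\<close>: past a connective, which resets the list,
  or past two quantifiers over the other variable, which displace \<open>y\<close>. A further
  quantifier over \<open>y\<close> overwrites the value.\<close>

lemma sat_skippable:
  assumes nf: "nf (insert y B) (q # qs) \<phi>" and \<phi>: "state_formula A \<phi>" "skippable y \<phi>"
  shows "sat M s (\<theta>(Y y := n)) \<phi> = sat M s \<theta> \<phi>"
proof -
  have nil: "sat M s (\<theta>(Y y := n)) \<psi> = sat M s \<theta> \<psi>"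
    if "nf B' [] \<psi>" "state_formula A \<psi>" "y \<in> B'" for B' \<theta> \<psi>
    by (rule sat_indep(1)[OF that(1,2), of "{y}"]) (use that(3) in auto)
  have two: "sat M s (\<theta>(Y y := n)) \<psi> = sat M s \<theta> \<psi>"
    if "nf B' (q1 # q2 # qs') \<psi>" "state_formula A \<psi>" "y \<in> B'" "qvar q1 \<noteq> y" "qvar q2 \<noteq> y"
    for B' \<theta> \<psi> q1 q2 qs'
    by (rule sat_indep(1)[OF that(1,2), of "{y}"]) (use that(3-5) in \<open>auto simp: numeral_2_eq_2\<close>)
  have twist: "sat M s (\<theta>(Y y := n, Y y' := m)) \<psi> = sat M s (\<theta>(Y y' := m)) \<psi>"
    if "y' \<noteq> y" "\<And>\<theta>. sat M s (\<theta>(Y y := n)) \<psi> = sat M s \<theta> \<psi>" for \<theta> y' m \<psi>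
    using that(2)[of "\<theta>(Y y' := m)"] that(1) by (simp add: fun_upd_twist[of "Y y" "Y y'"] del: fun_upd_apply)
  have nil2: "sat M s (\<theta>(Y y := n, Y y' := m)) \<psi> = sat M s (\<theta>(Y y' := m)) \<psi>"
    if "nf (insert y' (insert y B)) [] \<psi>" "state_formula A \<psi>" "y' \<noteq> y" for \<theta> y' m \<psi>
    by (rule twist[OF that(3) nil[OF that(1,2)]]) simp
  \<comment> \<open>There are only two variables, so two successive quantifiers that avoid
    \<open>y\<close> bind the same one.\<close>
  have other: "y'' = y'" if "y' \<noteq> y" "y'' \<noteq> y" for y' y''
    using that by (cases y; cases y'; cases y'') auto
  have quant: "sat M s (\<theta>(Y y := n, Y y' := m)) \<psi> = sat M s (\<theta>(Y y' := m)) \<psi>"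
    if \<psi>: "nf (insert y' (insert y B)) (q1 # qs') \<psi>" "qvar q1 = y'" "state_formula A \<psi>"
      and y': "y' \<noteq> y" and strat: "\<And>t1 t2 \<chi>. \<psi> \<noteq> Strat t1 t2 \<chi>" for y' q1 qs' \<psi> m \<theta>
  proof (cases \<psi>)
    case (FAll y'' \<psi>')
    show ?thesis
    proof (cases "y'' = y")
      case False
      then have "y'' = y'" using other y' by blast
      then have "sat M s (\<theta>(Y y := n)) \<psi>' = sat M s \<theta> \<psi>'" for \<theta>
        using FAll \<psi> y' two[of "insert y' (insert y B)" "AllQ y'" q1 qs' \<psi>'] by simp
      then show ?thesis
        using FAll \<open>y'' = y'\<close> twist[OF y', of \<psi>'] by (simp del: fun_upd_apply)
    qed (use FAll y' in \<open>simp add: fun_upd_twist[of "Y y" "Y y'"] del: fun_upd_apply\<close>)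
  next
    case (FEx y'' \<psi>')
    show ?thesis
    proof (cases "y'' = y")
      case False
      then have "y'' = y'" using other y' by blast
      then have "sat M s (\<theta>(Y y := n)) \<psi>' = sat M s \<theta> \<psi>'" for \<theta>
        using FEx \<psi> y' two[of "insert y' (insert y B)" "ExQ y'" q1 qs' \<psi>'] by simp
      then show ?thesis
        using FEx \<open>y'' = y'\<close> twist[OF y', of \<psi>'] by (simp del: fun_upd_apply)
    qed (use FEx y' in \<open>simp add: fun_upd_twist[of "Y y" "Y y'"] del: fun_upd_apply\<close>)
  qed (use \<psi>(1,3) y' strat in \<open>simp_all add: nil2 del: fun_upd_apply\<close>)
  show ?thesis
  proof (cases \<phi>)
    case (FAll y' \<psi>)
    show ?thesis
    proof (cases "y' = y")
      case False
      moreover have "\<psi> \<noteq> Strat t1 t2 \<chi>" for t1 t2 \<chi> using \<phi>(2) FAll False by auto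
      ultimately show ?thesis
        using FAll nf \<phi>(1) quant[of y' "AllQ y'" "q # qs" \<psi>] by simp
    qed (simp add: FAll)
  next
    case (FEx y' \<psi>)
    show ?thesis
    proof (cases "y' = y")
      case False
      moreover have "\<psi> \<noteq> Strat t1 t2 \<chi>" for t1 t2 \<chi> using \<phi>(2) FEx False by auto
      ultimately show ?thesis
        using FEx nf \<phi>(1) quant[of y' "ExQ y'" "q # qs" \<psi>] by simp
    qed (simp add: FEx)
  qed (use nf \<phi> nil in auto)
qed

lemma extension_skippable:
  assumes "nf (insert y B) (q # qs) \<phi>" "state_formula A \<phi>" "skippable y \<phi>"
  shows "extension M \<theta> (FEx y \<phi>) = extension M \<theta> \<phi>" "extension M \<theta> (FAll y \<phi>) = extension M \<theta> \<phi>"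
  by (simp_all add: extension_def sat_skippable[OF assms])

lemma globalMC_skippable:
  shows "skippable Y1 \<phi> \<Longrightarrow> globalMC M (FEx Y1 \<phi>) \<theta> = globalMC M \<phi> \<theta>"
    and "skippable Y2 \<phi> \<Longrightarrow> globalMC M (FAll Y2 \<phi>) \<theta> = globalMC M \<phi> \<theta>"
proof -
  have Y: "y = Y1 \<or> y = Y2" for y by (cases y) auto
  show "globalMC M (FEx Y1 \<phi>) \<theta> = globalMC M \<phi> \<theta>" if "skippable Y1 \<phi>"
  proof (cases \<phi>)
    case (FAll y \<psi>)
    then show ?thesis using that Y[of y] by (cases \<psi>) auto
  qed (use that in auto)
  show "globalMC M (FAll Y2 \<phi>) \<theta> = globalMC M \<phi> \<theta>" if "skippable Y2 \<phi>"
  proof (cases \<phi>)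
    case (FEx y \<psi>)
    then show ?thesis using that Y[of y] by (cases \<psi>) auto
  qed (use that in auto)
qed


section \<open>Correctness\<close>

fun prefixed :: "quant list \<Rightarrow> 'p sfm \<Rightarrow> 'p sfm" where
  "prefixed [] \<phi> = \<phi>"
| "prefixed (AllQ y # qs) \<phi> = FAll y (prefixed qs \<phi>)"
| "prefixed (ExQ y # qs) \<phi> = FEx y (prefixed qs \<phi>)"

lemma extension_prefixed:
  "extension M \<theta> (prefixed qs \<phi>) = interp qs (\<lambda>\<theta>. extension M \<theta> \<phi>) \<theta>"
proof (induction qs arbitrary: \<theta>)
  case (Cons q qs)
  have "extension M \<theta> (FEx y \<psi>) = (SUP n. extension M (\<theta>(Y y := n)) \<psi>)"
    "extension M \<theta> (FAll y \<psi>) = (INF n. extension M (\<theta>(Y y := n)) \<psi>)" for y and \<psi> :: "'c sfm"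
    by (auto simp: extension_def)
  then show ?case using Cons by (cases q) (simp_all del: fun_upd_apply)
qed simp

context
  fixes M :: "('ag, 's, 'p) hdmas"
  assumes M: "is_hdmas M" and fin: "finite (states M)"
begin

text \<open>\<open>B\<close> contains the variables of the prefix, so the normal form of
  \<open>\<chi>\<close> relative to \<open>B\<close> makes the arguments independent of them. The
  induction hypothesis is thus needed only at the given \<open>\<theta>\<close>.\<close>

lemma stratMC_correct:
  assumes qs: "set qs \<subseteq> {ExQ Y1, AllQ Y2}" "qvar ` set qs \<subseteq> B"
    and t: "t1 \<noteq> Y Y2" "t2 \<noteq> Y Y1"
    and \<chi>: "nf_t B \<chi>" "temp_formula A \<chi>"
    and IH: "\<And>\<psi>. size \<psi> < size \<chi> \<Longrightarrow> nf B [] \<psi> \<Longrightarrow> state_formula A \<psi> \<Longrightarrow>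
      globalMC M \<psi> \<theta> = Some (extension M \<theta> \<psi>)"
  shows "stratMC M qs t1 t2 \<chi> \<theta> = Some (extension M \<theta> (prefixed qs (Strat t1 t2 \<chi>)))"
proof -
  define P where "P = interp qs (\<lambda>\<theta>. cpre M (\<theta> t1) (\<theta> t2)) \<theta>"
  note dir = directed_cpre[OF M t]
  have P: "mono P" "P (states M) = states M" "P X \<subseteq> states M" "P {} = {}" for X
    using interp_preimage_fns[OF dir, of qs \<theta>] by (auto simp: P_def preimage_fns_def)
  have preImg: "preImg M t1 t2 X \<theta> qs = P X" if "X \<subseteq> states M" for X
    \<comment> \<open>Commutation with evaluation at \<open>X\<close> moves the prefix from sets of
      states to functions.\<close>
    unfolding P_def preImg_eq_interp[OF M that fin]
    by (rule interp_commute[OF fin dir _ qs(1), symmetric]) (simp add: mono_def le_fun_def)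
  have indep: "extension M \<theta>' \<psi> = extension M \<theta> \<psi>"
    if "nf B [] \<psi>" "state_formula A \<psi>" "\<And>t. t \<notin> Y ` qvar ` set qs \<Longrightarrow> \<theta>' t = \<theta> t" for \<psi> \<theta>'
  proof -
    have "sat M s \<theta>' \<psi> = sat M s \<theta> \<psi>" for s
      by (rule sat_indep(1)[OF that(1,2) qs(2)]) (use that(3) in auto)
    then show ?thesis by (simp add: extension_def)
  qed
  \<comment> \<open>The second use of commutation: \<open>\<Phi>\<close> turns the preimage for
    fixed numbers of agents into the winning region, and hence the quantified preimage
    \<open>P\<close> into the quantified region.\<close>
  have ext: "extension M \<theta> (prefixed qs (Strat t1 t2 \<chi>)) = \<Phi> P"
    if "mono \<Phi>" and "\<And>\<theta>'. (\<And>t. t \<notin> Y ` qvar ` set qs \<Longrightarrow> \<theta>' t = \<theta> t) \<Longrightarrow>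
      extension M \<theta>' (Strat t1 t2 \<chi>) = \<Phi> (cpre M (\<theta>' t1) (\<theta>' t2))" for \<Phi>
    unfolding P_def extension_prefixed interp_commute[OF fin dir that(1) qs(1)]
    by (rule interp_cong) (rule that(2))
  have win: "extension M \<theta>' (Strat t1 t2 \<chi>) = win M (\<theta>' t1) (\<theta>' t2) (\<lambda>\<pi>. sat_play M \<pi> \<theta>' \<chi>)" for \<theta>'
    by (simp add: extension_def win_def)
  show ?thesis
  proof (cases \<chi>)
    case (Nxt \<psi>)
    let ?Q = "extension M \<theta> \<psi>"
    have \<psi>: "nf B [] \<psi>" "state_formula A \<psi>" using \<chi> Nxt by auto
    have "extension M \<theta> (prefixed qs (Strat t1 t2 \<chi>)) = P ?Q"
    proof (rule ext)
      show "mono (\<lambda>F :: 's set \<Rightarrow> 's set. F ?Q)" by (simp add: mono_def le_fun_def)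
      fix \<theta>' assume "\<And>t. t \<notin> Y ` qvar ` set qs \<Longrightarrow> \<theta>' t = \<theta> t"
      then have Q: "extension M \<theta>' \<psi> = ?Q" by (rule indep[OF \<psi>])
      show "extension M \<theta>' (Strat t1 t2 \<chi>) = cpre M (\<theta>' t1) (\<theta>' t2) ?Q"
        unfolding win win_next[OF M, symmetric] Q[symmetric]
        by (rule win_cong[OF M]) (simp add: Nxt extension_def)
    qed
    moreover have "globalMC M \<psi> \<theta> = Some ?Q" using Nxt \<psi> by (intro IH) auto
    moreover have "?Q \<subseteq> states M" by (auto simp: extension_def)
    ultimately show ?thesis using Nxt preImg by simp
  next
    case (Glob \<psi>)
    let ?Q = "extension M \<theta> \<psi>"
    let ?F = "\<lambda>F X. F X \<inter> ?Q"
    have \<psi>: "nf B [] \<psi>" "state_formula A \<psi>" using \<chi> Glob by auto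
    have QS: "?Q \<subseteq> states M" by (auto simp: extension_def)
    have ext: "extension M \<theta> (prefixed qs (Strat t1 t2 \<chi>)) = gfp (?F P)"
    proof (rule ext)
      show "mono (\<lambda>F. gfp (?F F))" by (rule monoI, rule gfp_mono) (auto simp: le_fun_def)
      fix \<theta>' assume "\<And>t. t \<notin> Y ` qvar ` set qs \<Longrightarrow> \<theta>' t = \<theta> t"
      then have Q: "extension M \<theta>' \<psi> = ?Q" by (rule indep[OF \<psi>])
      show "extension M \<theta>' (Strat t1 t2 \<chi>) = gfp (?F (cpre M (\<theta>' t1) (\<theta>' t2)))"
        unfolding win win_globally[OF M, symmetric] Q[symmetric]
        by (rule win_cong[OF M]) (simp add: Glob extension_def)
    qed
    have "\<exists>W. while_option (\<lambda>(W, V). \<not> W \<subseteq> V) (\<lambda>(W, V). (V, ?F (\<lambda>X. preImg M t1 t2 X \<theta> qs) V))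
        (states M, ?F (\<lambda>X. preImg M t1 t2 X \<theta> qs) (states M)) = Some (W, gfp (?F P))"
      by (rule while_option_gfp[OF _ fin]) (use P QS preImg in \<open>auto simp: mono_def dest: subsetD[OF P(3)]\<close>)
    \<comment> \<open>The start of the loop is one application of the operator to all states,
      because \<open>P\<close> maps \<open>states M\<close> to itself.\<close>
    moreover have "?F (\<lambda>X. preImg M t1 t2 X \<theta> qs) (states M) = ?Q"
      using P(2) QS preImg[OF subset_refl] by auto
    ultimately obtain W where "while_option (\<lambda>(W, V). \<not> W \<subseteq> V)
        (\<lambda>(W, V). (V, preImg M t1 t2 V \<theta> qs \<inter> ?Q)) (states M, ?Q) = Some (W, gfp (?F P))"
      by auto
    moreover have "globalMC M \<psi> \<theta> = Some ?Q" using Glob \<psi> by (intro IH) auto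
    ultimately show ?thesis using Glob ext by simp
  next
    case (Until \<psi>1 \<psi>2)
    let ?Q1 = "extension M \<theta> \<psi>1" and ?Q2 = "extension M \<theta> \<psi>2"
    let ?F = "\<lambda>F X. ?Q2 \<union> (F X \<inter> ?Q1)"
    have \<psi>1: "nf B [] \<psi>1" "state_formula A \<psi>1" using \<chi> Until by auto
    have \<psi>2: "nf B [] \<psi>2" "state_formula A \<psi>2" using \<chi> Until by auto
    have QS: "?Q2 \<subseteq> states M" by (auto simp: extension_def)
    have ext: "extension M \<theta> (prefixed qs (Strat t1 t2 \<chi>)) = lfp (?F P)"
    proof (rule ext)
      show "mono (\<lambda>F. lfp (?F F))" by (rule monoI, rule lfp_mono) (auto simp: le_fun_def)
      fix \<theta>' assume \<theta>': "\<And>t. t \<notin> Y ` qvar ` set qs \<Longrightarrow> \<theta>' t = \<theta> t"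
      have Q1: "extension M \<theta>' \<psi>1 = ?Q1" by (rule indep[OF \<psi>1 \<theta>'])
      have Q2: "extension M \<theta>' \<psi>2 = ?Q2" by (rule indep[OF \<psi>2 \<theta>'])
      show "extension M \<theta>' (Strat t1 t2 \<chi>) = lfp (?F (cpre M (\<theta>' t1) (\<theta>' t2)))"
        unfolding win win_until[OF M QS fin, symmetric]
        by (rule win_cong[OF M], unfold Q1[symmetric] Q2[symmetric]) (simp add: Until extension_def)
    qed
    have "\<exists>W. while_option (\<lambda>(W, V). \<not> V \<subseteq> W) (\<lambda>(W, V). (V, ?F (\<lambda>X. preImg M t1 t2 X \<theta> qs) V))
        ({}, ?F (\<lambda>X. preImg M t1 t2 X \<theta> qs) {}) = Some (W, lfp (?F P))"
      by (rule while_option_lfp[OF _ fin]) (use P QS preImg in \<open>auto simp: mono_def dest: subsetD[OF P(3)]\<close>)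
    \<comment> \<open>Likewise, \<open>P\<close> maps \<open>{}\<close> to itself, so the loop
      starts with one application to \<open>{}\<close>.\<close>
    moreover have "?F (\<lambda>X. preImg M t1 t2 X \<theta> qs) {} = ?Q2"
      using P(4) preImg[OF empty_subsetI] by auto
    ultimately obtain W where "while_option (\<lambda>(W, V). \<not> V \<subseteq> W)
        (\<lambda>(W, V). (V, ?Q2 \<union> (preImg M t1 t2 V \<theta> qs \<inter> ?Q1))) ({}, ?Q2) = Some (W, lfp (?F P))"
      by auto
    moreover have "globalMC M \<psi>1 \<theta> = Some ?Q1" using Until \<psi>1 by (intro IH) auto
    moreover have "globalMC M \<psi>2 \<theta> = Some ?Q2" using Until \<psi>2 by (intro IH) auto
    ultimately show ?thesis using Until ext by simp
  qed
qed

text \<open>The induction is on size because an equation may consume two quantifiers and a strategic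
  operator at once. \<open>\<theta>\<close> stays fixed, as the algorithm passes it unchanged below
  quantifiers; \<open>B\<close> and \<open>qs\<close> vary to record the context for the normal
  form.\<close>

lemma globalMC_correct:
  assumes "nf B qs \<phi>" "state_formula A \<phi>"
  shows "globalMC M \<phi> \<theta> = Some (extension M \<theta> \<phi>)"
  using assms
proof (induction \<phi> arbitrary: B qs rule: measure_induct_rule[where f = size])
  case (less \<phi>)
  have strat: "stratMC M qs' t1 t2 \<chi> \<theta> = Some (extension M \<theta> \<phi>)"
    if "\<phi> = prefixed qs' (Strat t1 t2 \<chi>)" "set qs' \<subseteq> {ExQ Y1, AllQ Y2}" "qvar ` set qs' \<subseteq> B'"
      "nf_t B' \<chi>" "state_formula A (Strat t1 t2 \<chi>)" "size \<chi> < size \<phi>" for qs' t1 t2 \<chi> B'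
    unfolding that(1)
    by (rule stratMC_correct[OF that(2,3) _ _ that(4)]) (use that(5,6) less.IH in auto)
  show ?case
  proof (cases \<phi>)
    case Top
    then show ?thesis by (simp add: extension_def)
  next
    case (Prop p)
    then show ?thesis by (simp add: extension_def)
  next
    case (Neg \<psi>)
    then have "globalMC M \<psi> \<theta> = Some (extension M \<theta> \<psi>)"
      using less.prems by (intro less.IH) auto
    then show ?thesis using Neg by (auto simp: extension_def)
  next
    case (Conj \<psi>1 \<psi>2)
    then have "globalMC M \<psi>1 \<theta> = Some (extension M \<theta> \<psi>1)"
      "globalMC M \<psi>2 \<theta> = Some (extension M \<theta> \<psi>2)"
      using less.prems less.IH[of \<psi>1 B "[]"] less.IH[of \<psi>2 B "[]"] by auto
    then show ?thesis using Conj by (auto simp: extension_def)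
  next
    case (Disj \<psi>1 \<psi>2)
    then have "globalMC M \<psi>1 \<theta> = Some (extension M \<theta> \<psi>1)"
      "globalMC M \<psi>2 \<theta> = Some (extension M \<theta> \<psi>2)"
      using less.prems less.IH[of \<psi>1 B "[]"] less.IH[of \<psi>2 B "[]"] by auto
    then show ?thesis using Disj by (auto simp: extension_def)
  next
    case (Strat t1 t2 \<chi>)
    then show ?thesis using strat[of "[]" t1 t2 \<chi> B] less.prems by simp
  next
    case (FAll y \<psi>)
    then have y: "y = Y2" using less.prems by (cases y) auto
    \<comment> \<open>Either the quantifier starts a prefix of length one or two, or it is vacuous
      and the algorithm skips it.\<close>
    consider t1 t2 \<chi> where "\<psi> = Strat t1 t2 \<chi>" | t1 t2 \<chi> where "\<psi> = FEx Y1 (Strat t1 t2 \<chi>)"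
      | "skippable Y2 \<psi>"
      using less.prems FAll y by (cases "(Y2, \<psi>)" rule: skippable.cases) (auto; metis yvar.exhaust)+
    then show ?thesis
    proof cases
      case 1
      then show ?thesis
        using strat[of "[AllQ Y2]" _ _ _ "insert Y2 B"] less.prems FAll y by simp
    next
      case 2
      then show ?thesis
        using strat[of "[AllQ Y2, ExQ Y1]" _ _ _ "insert Y1 (insert Y2 B)"] less.prems FAll y by simp
    next
      case 3
      have "globalMC M \<psi> \<theta> = Some (extension M \<theta> \<psi>)"
        using less.prems FAll by (intro less.IH) auto
      then show ?thesis
        using 3 FAll y less.prems globalMC_skippable(2)[of \<psi> M \<theta>]
          extension_skippable(2)[of Y2 B "AllQ Y2" qs \<psi> A M \<theta>]
        by simp
    qed
  next
    case (FEx y \<psi>)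
    then have y: "y = Y1" using less.prems by (cases y) auto
    consider t1 t2 \<chi> where "\<psi> = Strat t1 t2 \<chi>" | t1 t2 \<chi> where "\<psi> = FAll Y2 (Strat t1 t2 \<chi>)"
      | "skippable Y1 \<psi>"
      using less.prems FEx y by (cases "(Y1, \<psi>)" rule: skippable.cases) (auto; metis yvar.exhaust)+
    then show ?thesis
    proof cases
      case 1
      then show ?thesis
        using strat[of "[ExQ Y1]" _ _ _ "insert Y1 B"] less.prems FEx y by simp
    next
      case 2
      then show ?thesis
        using strat[of "[ExQ Y1, AllQ Y2]" _ _ _ "insert Y2 (insert Y1 B)"] less.prems FEx y by simp
    next
      case 3
      have "globalMC M \<psi> \<theta> = Some (extension M \<theta> \<psi>)"
        using less.prems FEx by (intro less.IH) auto
      then show ?thesis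
        using 3 FEx y less.prems globalMC_skippable(1)[of \<psi> M \<theta>]
          extension_skippable(1)[of Y1 B "ExQ Y1" qs \<psi> A M \<theta>]
        by simp
    qed
  qed
qed

end

theorem theorem4:
  fixes M :: "('ag, 's, 'p) hdmas" and \<phi> :: "'p sfm" and \<theta> :: "trm \<Rightarrow> nat"
  assumes "is_hdmas M"
    and "finite (states M)"
    and "state_formula (props M) \<phi>"
    and "normal_form \<phi>"
    and "is_assignment \<theta>"
  shows "globalMC M \<phi> \<theta> = Some (extension M \<theta> \<phi>)"
  using globalMC_correct assms unfolding normal_form_def by blast

end
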